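(* Let $0\le r\le n$. The set $$\{1\}\sqcup\{x_F\cdot x_{\mathcal F}: F\subseteq[n],\ |F|\le r-1,\ \mathcal F\text{ is retral in }U_{r,n}/F\}$$ forms a basis (over $\mathbb Q$) of the augmented Chow ring $A^\bullet(U_{r,n})$.
   Context: **Matroid and fan.** $U_{r,n}$ is the uniform matroid of rank $r$ on $[n]=\{1,\dots,n\}$: its independent sets are the subsets of size $\le r$ and its proper flats are the subsets of size $\le r-1$. Let $e_1,\dots,e_n$ be the basis of $N=\mathbb Z^n$, $\ell_1,\dots,\ell_n$ the dual basis, $e_S=\sum_{i\in S}e_i$. The augmented Bergman fan $\Sigma_{U_{r,n}}$ is the unimodular fan in $\mathbb R^n$ whose cones are $\operatorname{cone}(e_i)_{i\in I}+\operatorname{cone}(-e_{[n]\setminus F})_{F\in\mathcal F}$, where $\mathcal F$ is a (possibly empty) chain of proper flats and $I$ is an independent set contained in every member of $\mathcal F$. Denote by $y_i$ the variable attached to the ray $\operatorname{cone}(e_i)$ and by $x_F$ the variable attached to the ray $\operatorname{cone}(-e_{[n]\setminus F})$. **Augmented Chow ring.** Let $\mathbb Q[\Sigma_{U_{r,n}}]$ be the Stanley–Reisner ring: the polynomial ring on the variables of the rays of $\Sigma_{U_{r,n}}$ modulo the monomials $\prod$ of variables of sets of rays that do not span a cone. The augmented Chow ring is $A^\bullet(U_{r,n})=\mathbb Q[\Sigma_{U_{r,n}}]/(\theta_1,\dots,\theta_n)$ with $\theta_i=\sum_\rho\langle\ell_i,u_\rho\rangle x_\rho$ ($u_\rho$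 the primitive generator of $\rho$), i.e. $\theta_i=y_i-\sum_{F\not\ni i,\,|F|\le r-1}x_F$ when $r\ge1$. It is the Chow ring of the toric variety of $\Sigma_{U_{r,n}}$ and equals the zeroth Koszul homology $H_0(K(\mathbb Q[\Sigma_{U_{r,n}}]))_\bullet$. **Retral flags.** For a proper flat $F$, the flats of the contraction $U_{r,n}/F$ are identified with the flats of $U_{r,n}$ containing $F$. A flag of proper flats in $U_{r,n}/F$ always contains the minimum $F$: $\mathcal F=\{F=F_0\subsetneq F_1\subsetneq\dots\subsetneq F_s\}$, $s\ge0$, $|F_s|\le r-1$; set $F_{s+1}=[n]$. It is *retral* if for every $1\le k\le s$ with $|F_k\setminus F_{k-1}|=1$ (i.e. $F_k$ covers $F_{k-1}$), the unique element of $F_k\setminus F_{k-1}$ is $\max(F_{k+1}\setminus F_{k-1})$. Set $x_{\mathcal F}=\prod_{k=1}^sx_{F_k}$. *)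

theory Defs
  imports
    Complex_Main
    "HOL-Library.Poly_Mapping"
    "HOL-Algebra.QuotRing"
    "HOL-Algebra.Embedded_Algebras"
begin

section \<open>The uniform matroid\<close>

definition uniform_indep :: "nat \<Rightarrow> nat \<Rightarrow> nat set \<Rightarrow> bool" where
  "uniform_indep r n I \<longleftrightarrow> I \<subseteq> {1..n} \<and> card I \<le> r"

text \<open>The condition \<open>|F| \<le> r - 1\<close> is written \<open>card F < r\<close>, so that there are no proper flats
  for \<open>r = 0\<close> (subtraction on the naturals would truncate).\<close>

definition proper_flat :: "nat \<Rightarrow> nat \<Rightarrow> nat set \<Rightarrow> bool" where
  "proper_flat r n F \<longleftrightarrow> F \<subseteq> {1..n} \<and> card F < r"


section \<open>The augmented Bergman fan\<close>

text \<open>\<open>RayE i\<close> labels the ray spanned by \<open>e\<^sub>i\<close> (with variable \<open>y\<^sub>i\<close>), and \<open>RayF F\<close> labels the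
  ray spanned by \<open>-e\<^bsub>[n] - F\<^esub>\<close> (with variable \<open>x\<^bsub>F\<^esub>\<close>).\<close>

datatype ray = RayE nat | RayF "nat set"

definition rays :: "nat \<Rightarrow> nat \<Rightarrow> ray set" where
  "rays r n = {RayE i | i. uniform_indep r n {i}} \<union> {RayF F | F. proper_flat r n F}"

text \<open>Vectors of \<open>\<int>\<^sup>n\<close> and \<open>\<real>\<^sup>n\<close> are functions on the naturals vanishing outside \<open>{1..n}\<close>.\<close>

fun ray_gen :: "nat \<Rightarrow> ray \<Rightarrow> nat \<Rightarrow> int" where
  "ray_gen n (RayE i) = (\<lambda>j. if j = i then 1 else 0)"
| "ray_gen n (RayF F) = (\<lambda>j. if j \<in> {1..n} - F then -1 else 0)"

definition cone_of :: "nat \<Rightarrow> ray set \<Rightarrow> (nat \<Rightarrow> real) set" where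
  "cone_of n S = {(\<lambda>j. \<Sum>\<rho>\<in>S. c \<rho> * of_int (ray_gen n \<rho> j)) | c. \<forall>\<rho>\<in>S. 0 \<le> c \<rho>}"

text \<open>The sum of the cones spanned by two sets of rays is the cone spanned by their union.\<close>

definition aug_bergman_fan :: "nat \<Rightarrow> nat \<Rightarrow> (nat \<Rightarrow> real) set set" where
  "aug_bergman_fan r n = {cone_of n (RayE ` I \<union> RayF ` C) | I C.
     uniform_indep r n I \<and> subset.chain {F. proper_flat r n F} C \<and> (\<forall>F\<in>C. I \<subseteq> F)}"


section \<open>The augmented Chow ring\<close>

type_synonym 'v mpoly = "('v \<Rightarrow>\<^sub>0 nat) \<Rightarrow>\<^sub>0 rat"

definition Var :: "'v \<Rightarrow> 'v mpoly" where
  "Var v = Poly_Mapping.single (Poly_Mapping.single v 1) 1"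

definition Const :: "rat \<Rightarrow> 'v mpoly" where
  "Const c = Poly_Mapping.single 0 c"

definition poly_ring :: "'v set \<Rightarrow> 'v mpoly ring" where
  "poly_ring V = \<lparr>carrier = {p. \<forall>m\<in>Poly_Mapping.keys p. Poly_Mapping.keys m \<subseteq> V},
     monoid.mult = (*), monoid.one = 1, ring.zero = 0, ring.add = (+)\<rparr>"

definition sr_ideal :: "nat \<Rightarrow> nat \<Rightarrow> ray mpoly set" where
  "sr_ideal r n = genideal (poly_ring (rays r n))
     {\<Prod>\<rho>\<in>S. Var \<rho> | S. S \<subseteq> rays r n \<and> cone_of n S \<notin> aug_bergman_fan r n}"

definition sr_ring :: "nat \<Rightarrow> nat \<Rightarrow> ray mpoly set ring" where
  "sr_ring r n = poly_ring (rays r n) Quot sr_ideal r n"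

definition sr_class :: "nat \<Rightarrow> nat \<Rightarrow> ray mpoly \<Rightarrow> ray mpoly set" where
  "sr_class r n p = sr_ideal r n +>\<^bsub>poly_ring (rays r n)\<^esub> p"

definition theta :: "nat \<Rightarrow> nat \<Rightarrow> nat \<Rightarrow> ray mpoly" where
  "theta r n i = (\<Sum>\<rho>\<in>rays r n. Const (of_int (ray_gen n \<rho> i)) * Var \<rho>)"

definition linear_ideal :: "nat \<Rightarrow> nat \<Rightarrow> ray mpoly set set" where
  "linear_ideal r n = genideal (sr_ring r n) (sr_class r n ` theta r n ` {1..n})"

definition aug_chow_ring :: "nat \<Rightarrow> nat \<Rightarrow> ray mpoly set set ring" where
  "aug_chow_ring r n = sr_ring r n Quot linear_ideal r n"

definition chow_class :: "nat \<Rightarrow> nat \<Rightarrow> ray mpoly \<Rightarrow> ray mpoly set set" where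
  "chow_class r n p = linear_ideal r n +>\<^bsub>sr_ring r n\<^esub> sr_class r n p"

text \<open>The copy of \<open>\<rat>\<close> inside the augmented Chow ring that makes it a \<open>\<rat>\<close>-algebra.\<close>

definition chow_scalars :: "nat \<Rightarrow> nat \<Rightarrow> ray mpoly set set set" where
  "chow_scalars r n = range (\<lambda>c. chow_class r n (Const c))"

definition is_basis :: "('a, 'b) ring_scheme \<Rightarrow> 'a set \<Rightarrow> 'a set \<Rightarrow> bool" where
  "is_basis R K B \<longleftrightarrow> (\<exists>us. distinct us \<and> set us = B \<and>
     ring.independent R K us \<and> ring.Span R K us = carrier R)"


section \<open>Retral flags\<close>

text \<open>A flag \<open>F = F\<^sub>0 \<subset> F\<^sub>1 \<subset> \<dots> \<subset> F\<^sub>s\<close> of proper flats of the contraction by \<open>F\<close> is the list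
  \<open>[F\<^sub>0, \<dots>, F\<^sub>s]\<close>, whose entries are flats of the uniform matroid itself.\<close>

definition contraction_flag :: "nat \<Rightarrow> nat \<Rightarrow> nat set \<Rightarrow> nat set list \<Rightarrow> bool" where
  "contraction_flag r n F fl \<longleftrightarrow> fl \<noteq> [] \<and> hd fl = F \<and> sorted_wrt (\<subset>) fl \<and>
     (\<forall>G\<in>set fl. proper_flat r n G)"

text \<open>Appending \<open>{1..n}\<close> to the list supplies \<open>F\<^bsub>s+1\<^esub> = [n]\<close>.\<close>

definition retral :: "nat \<Rightarrow> nat \<Rightarrow> nat set \<Rightarrow> nat set list \<Rightarrow> bool" where
  "retral r n F fl \<longleftrightarrow> contraction_flag r n F fl \<and>
     (let G = (\<lambda>k. (fl @ [{1..n}]) ! k) in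
      \<forall>k. 1 \<le> k \<and> k < length fl \<and> card (G k - G (k - 1)) = 1 \<longrightarrow>
        G k - G (k - 1) = {Max (G (k + 1) - G (k - 1))})"

definition flag_monomial :: "nat set list \<Rightarrow> ray mpoly" where
  "flag_monomial fl = (\<Prod>G\<leftarrow>tl fl. Var (RayF G))"

definition retral_monomials :: "nat \<Rightarrow> nat \<Rightarrow> ray mpoly set" where
  "retral_monomials r n =
     insert 1 {Var (RayF F) * flag_monomial fl | F fl. proper_flat r n F \<and> retral r n F fl}"

end

theory Submission
  imports Defs "HOL-Library.Function_Algebras"
begin

text \<open>
  The augmented Chow ring is the quotient of the polynomial ring by a single ideal, \<open>chow_ideal\<close>.
  The linear forms eliminate the \<open>y\<^sub>i\<close>, and what remains are the relations
  \<open>x\<^bsub>F\<^esub> x\<^bsub>G\<^esub> = 0\<close> for incomparable flats and \<open>x\<^bsub>F\<^esub> \<Sum>\<^bsub>G \<notni> i\<^esub> x\<^bsub>G\<^esub> = 0\<close> for \<open>i \<notin> F\<close>.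

  The retral monomials span by straightening. The relations first remove all powers
  (\<open>chain_monomial_times_flats\<close>). Then, if a chain has a singleton block \<open>{i}\<close> whose element is
  smaller than the maximum \<open>j\<close> of the next block, the difference of the relations of \<open>i\<close> and \<open>j\<close>
  replaces the flat at the end of the singleton block by flats with a larger sum of elements
  (\<open>chain_monomial_in_subspace\<close>).

  Independence is first shown in rank \<open>r = n\<close>, where the fan is complete, by a deformation. If the
  linear relations \<open>\<theta>\<^sub>i = 0\<close> are replaced by \<open>\<theta>\<^sub>i = -i\<close>, the monomial relations and the new linear
  ones have as many common zeros as the fan has maximal cones. These points are indexed by the
  lists of distinct elements of \<open>{1..n}\<close>: the list \<open>x\<^sub>1, \<dots>, x\<^sub>k\<close> gives a point at which the
  nonzero \<open>x\<^bsub>F\<^esub>\<close> are those whose \<open>F\<close> is the complement of some \<open>{x\<^sub>j, \<dots>, x\<^sub>k}\<close>. Every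
  homogeneous relation of the Chow ring holds at the points up to lower degree
  (\<open>component_chow_ideal\<close>). Hence the retral monomials span the space of functions on the points,
  and a linear relation among them would allow to leave one of them out. So it suffices that there are not more retral monomials than points, for which
  \<open>flag_word\<close> encodes retral flags injectively as lists (\<open>flag_word_inj\<close>).

  In rank \<open>r < n\<close> the Chow ring is the quotient of the one in rank \<open>n\<close> by the variables of the
  flats with at least \<open>r\<close> elements. Straightening never makes the largest flat of a chain smaller.
  So this ideal is spanned by those retral monomials of rank \<open>n\<close> that contain such a flat; the
  others are the retral monomials of rank \<open>r\<close>, which therefore stay independent
  (\<open>retral_not_in_span\<close>).
\<close>

section \<open>Multivariate polynomials\<close>

lemma Const_0 [simp]: "Const 0 = 0"
  and Const_1 [simp]: "Const 1 = 1"
  and Const_add: "Const (a + b) = Const a + Const b"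
  and Const_mult: "Const (a * b) = Const a * Const b"
  and Const_minus: "Const (- a) = - Const a"
  by (simp_all add: Const_def single_add mult_single single_uminus)

lemma Const_mult_single: "Const c * Poly_Mapping.single m d = Poly_Mapping.single m (c * d)"
  by (simp add: Const_def mult_single)

lemma Var_mult_single:
  "Var v * Poly_Mapping.single m c = Poly_Mapping.single (m + Poly_Mapping.single v 1) c"
  by (simp add: Var_def mult_single add.commute)

lemma mpoly_eq_sum_single:
  "(p :: 'v mpoly) = (\<Sum>m\<in>Poly_Mapping.keys p. Poly_Mapping.single m (Poly_Mapping.lookup p m))"
  by (rule poly_mapping_eqI)
     (auto simp: lookup_sum lookup_single when_def in_keys_iff)

interpretation mp: vector_space "\<lambda>c (p :: 'v mpoly). Const c * p"
  by unfold_locales (simp_all add: algebra_simps Const_add Const_mult)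

definition poly_carrier :: "'v set \<Rightarrow> 'v mpoly set" where
  "poly_carrier V = {p. \<forall>m\<in>Poly_Mapping.keys p. Poly_Mapping.keys m \<subseteq> V}"

lemma carrier_poly_ring [simp]: "carrier (poly_ring V) = poly_carrier V"
  by (simp add: poly_ring_def poly_carrier_def)

lemma poly_carrier_add: "p \<in> poly_carrier V \<Longrightarrow> q \<in> poly_carrier V \<Longrightarrow> p + q \<in> poly_carrier V"
  using Poly_Mapping.keys_add[of p q] unfolding poly_carrier_def by blast

lemma poly_carrier_uminus: "p \<in> poly_carrier V \<Longrightarrow> - p \<in> poly_carrier V"
  by (simp add: in_keys_iff poly_carrier_def)

lemma poly_carrier_diff: "p \<in> poly_carrier V \<Longrightarrow> q \<in> poly_carrier V \<Longrightarrow> p - q \<in> poly_carrier V"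
  using poly_carrier_add[OF _ poly_carrier_uminus, of p V q] by simp

lemma poly_carrier_mult:
  assumes "p \<in> poly_carrier V" "q \<in> poly_carrier V"
  shows "p * q \<in> poly_carrier V"
proof -
  have "Poly_Mapping.keys m \<subseteq> V" if m: "m \<in> Poly_Mapping.keys (p * q)" for m
  proof -
    obtain a b where "m = a + b" "a \<in> Poly_Mapping.keys p" "b \<in> Poly_Mapping.keys q"
      using m keys_mult[of p q] by blast
    then show ?thesis
      using assms Poly_Mapping.keys_add[of a b] unfolding poly_carrier_def by blast
  qed
  then show ?thesis unfolding poly_carrier_def by blast
qed

lemma poly_carrier_Const: "Const c \<in> poly_carrier V"
  by (simp add: Const_def poly_carrier_def)

lemma poly_carrier_one: "1 \<in> poly_carrier V"
  using poly_carrier_Const[of 1] by simp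

lemma poly_carrier_zero: "0 \<in> poly_carrier V"
  using poly_carrier_Const[of 0] by simp

lemma poly_carrier_Var: "v \<in> V \<Longrightarrow> Var v \<in> poly_carrier V"
  by (simp add: Var_def poly_carrier_def)

lemma poly_carrier_sum: "(\<And>x. x \<in> A \<Longrightarrow> f x \<in> poly_carrier V) \<Longrightarrow> sum f A \<in> poly_carrier V"
  by (induct A rule: infinite_finite_induct)
     (auto simp: poly_carrier_zero intro!: poly_carrier_add)

lemma poly_carrier_prod: "(\<And>x. x \<in> A \<Longrightarrow> f x \<in> poly_carrier V) \<Longrightarrow> prod f A \<in> poly_carrier V"
  by (induct A rule: infinite_finite_induct)
     (auto simp: poly_carrier_one intro!: poly_carrier_mult)

lemma poly_carrier_mono: "V \<subseteq> W \<Longrightarrow> poly_carrier V \<subseteq> poly_carrier W"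
  unfolding poly_carrier_def by blast

lemma subspace_poly_carrier: "mp.subspace (poly_carrier V)"
  by (intro mp.subspaceI poly_carrier_zero poly_carrier_add poly_carrier_mult poly_carrier_Const)

text \<open>Closure of an ideal or of a span under multiplication by arbitrary polynomials reduces in this
  way to multiplication by single variables, whose effect on evaluations is computed below.\<close>

lemma poly_carrier_induct [consumes 1, case_names Const add Var]:
  assumes p: "p \<in> poly_carrier V"
    and C: "\<And>c. P (Const c)"
    and A: "\<And>p q. p \<in> poly_carrier V \<Longrightarrow> q \<in> poly_carrier V \<Longrightarrow> P p \<Longrightarrow> P q \<Longrightarrow> P (p + q)"
    and M: "\<And>v p. v \<in> V \<Longrightarrow> p \<in> poly_carrier V \<Longrightarrow> P p \<Longrightarrow> P (Var v * p)"
  shows "P p"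
proof -
  have mono: "P (Poly_Mapping.single m c)"
    if "Poly_Mapping.keys m \<subseteq> V" "(\<Sum>v\<in>Poly_Mapping.keys m. Poly_Mapping.lookup m v) = k"
    for m :: "'a \<Rightarrow>\<^sub>0 nat" and c k
    using that
  proof (induction k arbitrary: m)
    case 0
    then have "Poly_Mapping.lookup m v = 0" for v
      by (cases "v \<in> Poly_Mapping.keys m") (auto simp: in_keys_iff)
    then have "m = 0" by (intro poly_mapping_eqI) simp
    then show ?case using C[of c] by (simp add: Const_def)
  next
    case (Suc k)
    then obtain v where v: "v \<in> Poly_Mapping.keys m"
      by (metis sum.empty ex_in_conv nat.simps(3))
    define m' where "m' = m - Poly_Mapping.single v 1"
    have lk: "Poly_Mapping.lookup m' = (Poly_Mapping.lookup m)(v := Poly_Mapping.lookup m v - 1)"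
      by (auto simp: m'_def lookup_minus lookup_single when_def fun_eq_iff)
    have m: "m = m' + Poly_Mapping.single v 1"
      using v by (intro poly_mapping_eqI) (auto simp: lookup_add lk lookup_single when_def in_keys_iff)
    have sub: "Poly_Mapping.keys m' \<subseteq> Poly_Mapping.keys m"
      by (auto simp: in_keys_iff lk split: if_splits)
    have "(\<Sum>v\<in>Poly_Mapping.keys m'. Poly_Mapping.lookup m' v)
        = (\<Sum>w\<in>Poly_Mapping.keys m. Poly_Mapping.lookup m' w)"
      using sub by (intro sum.mono_neutral_left) (auto simp: in_keys_iff)
    also have "\<dots> = (\<Sum>w\<in>Poly_Mapping.keys m - {v}. Poly_Mapping.lookup m w) + (Poly_Mapping.lookup m v - 1)"
      using v by (subst sum.remove[of _ v]) (auto simp: lk)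
    also have "Suc \<dots> = Suc k"
      using v Suc.prems(2) by (subst (asm) sum.remove[of _ v]) (auto simp: in_keys_iff)
    finally have "P (Poly_Mapping.single m' c)"
      using sub Suc.prems(1) by (intro Suc.IH) auto
    moreover have "Poly_Mapping.single m' c \<in> poly_carrier V"
      using sub Suc.prems(1) by (auto simp: poly_carrier_def)
    ultimately show ?case
      using M[of v "Poly_Mapping.single m' c"] v Suc.prems(1)
      unfolding Var_mult_single m[symmetric] by blast
  qed
  have "P (\<Sum>m\<in>M. Poly_Mapping.single m (Poly_Mapping.lookup p m))
      \<and> (\<Sum>m\<in>M. Poly_Mapping.single m (Poly_Mapping.lookup p m)) \<in> poly_carrier V"
    if "finite M" "\<forall>m\<in>M. Poly_Mapping.keys m \<subseteq> V" for M
    using that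
  proof (induction M rule: finite_induct)
    case empty
    then show ?case using C[of 0] by (simp add: poly_carrier_zero)
  next
    case (insert m M)
    have s: "Poly_Mapping.single m (Poly_Mapping.lookup p m) \<in> poly_carrier V"
      using insert.prems by (auto simp: poly_carrier_def)
    have "P (Poly_Mapping.single m (Poly_Mapping.lookup p m))"
      using insert.prems by (intro mono) auto
    with s insert show ?case
      unfolding sum.insert[OF insert.hyps] by (auto intro: A poly_carrier_add)
  qed
  then show ?thesis
    using p by (subst mpoly_eq_sum_single) (simp add: poly_carrier_def)
qed

lemma cring_poly_ring: "cring (poly_ring V)"
proof (rule cringI)
  have ops: "x \<oplus>\<^bsub>poly_ring V\<^esub> y = x + y" "x \<otimes>\<^bsub>poly_ring V\<^esub> y = x * y"
    "\<zero>\<^bsub>poly_ring V\<^esub> = 0" "\<one>\<^bsub>poly_ring V\<^esub> = 1" for x y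
    by (simp_all add: poly_ring_def)
  show "abelian_group (poly_ring V)"
  proof (rule abelian_groupI, unfold ops carrier_poly_ring)
    show "\<exists>y\<in>poly_carrier V. y + x = 0" if "x \<in> poly_carrier V" for x
      using that poly_carrier_uminus[of x V] by (intro bexI[of _ "- x"]) simp_all
  qed (simp_all add: poly_carrier_add poly_carrier_zero)
  show "comm_monoid (poly_ring V)"
    by (rule comm_monoidI, unfold ops carrier_poly_ring)
       (simp_all add: poly_carrier_mult poly_carrier_one algebra_simps)
qed (simp add: poly_ring_def algebra_simps)

section \<open>Faces of the augmented Bergman fan\<close>

definition face :: "nat \<Rightarrow> nat \<Rightarrow> ray set \<Rightarrow> bool" where
  "face r n S \<longleftrightarrow> (\<exists>I C. S = RayE ` I \<union> RayF ` C \<and> uniform_indep r n I \<and>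
     subset.chain {F. proper_flat r n F} C \<and> (\<forall>F\<in>C. I \<subseteq> F))"

lemma proper_flat_subset: "proper_flat r n F \<Longrightarrow> F \<subseteq> {1..n}"
  by (simp add: proper_flat_def)

lemma finite_proper_flats: "finite {F. proper_flat r n F}"
  by (rule finite_subset[of _ "Pow {1..n}"]) (auto simp: proper_flat_def)

lemma finite_proper_flat: "proper_flat r n F \<Longrightarrow> finite F"
  by (meson proper_flat_subset finite_atLeastAtMost finite_subset)

lemma proper_flat_psubset:
  assumes "r \<le> n" "proper_flat r n F"
  shows "F \<subset> {1..n}"
  using assms by (auto simp: proper_flat_def)

lemma RayE_in_rays: "RayE i \<in> rays r n \<longleftrightarrow> i \<in> {1..n} \<and> 1 \<le> r"
  by (auto simp: rays_def uniform_indep_def)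

lemma RayF_in_rays: "RayF F \<in> rays r n \<longleftrightarrow> proper_flat r n F"
  by (auto simp: rays_def)

lemma finite_rays: "finite (rays r n)"
proof -
  have "rays r n \<subseteq> RayE ` {1..n} \<union> RayF ` {F. proper_flat r n F}"
    by (auto simp: rays_def uniform_indep_def)
  then show ?thesis
    using finite_proper_flats by (meson finite_UnI finite_imageI finite_atLeastAtMost finite_subset)
qed

lemma face_imp_cone: "face r n S \<Longrightarrow> cone_of n S \<in> aug_bergman_fan r n"
  unfolding face_def aug_bergman_fan_def by blast

lemma gen_in_cone:
  assumes "finite S" "\<rho> \<in> S"
  shows "(\<lambda>j. of_int (ray_gen n \<rho> j)) \<in> cone_of n S"
proof -
  have "(\<lambda>j. of_int (ray_gen n \<rho> j)) =
      (\<lambda>j. \<Sum>\<sigma>\<in>S. (if \<sigma> = \<rho> then 1 else 0) * (of_int (ray_gen n \<sigma> j) :: real))"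
  proof
    fix j
    have "(\<Sum>\<sigma>\<in>S. (if \<sigma> = \<rho> then 1 else 0) * (of_int (ray_gen n \<sigma> j) :: real))
        = (\<Sum>\<sigma>\<in>S. if \<rho> = \<sigma> then of_int (ray_gen n \<sigma> j) else 0)"
      by (intro sum.cong) auto
    then show "of_int (ray_gen n \<rho> j) =
        (\<Sum>\<sigma>\<in>S. (if \<sigma> = \<rho> then 1 else 0) * (of_int (ray_gen n \<sigma> j) :: real))"
      using assms by simp
  qed
  then show ?thesis
    unfolding cone_of_def by (auto intro!: exI[of _ "\<lambda>\<sigma>. if \<sigma> = \<rho> then 1 else 0"])
qed

text \<open>As \<open>I\<close> is contained in the members of \<open>C\<close>, the generators \<open>-e\<^bsub>[n] - F\<^esub>\<close> have no coordinates in
  \<open>I\<close>. So the two kinds of generators are visible in complementary sets of coordinates.\<close>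

lemma cone_coordinates:
  assumes "finite I" "finite C" "I \<subseteq> {1..n}" "\<forall>F\<in>C. I \<subseteq> F"
    and v: "v \<in> cone_of n (RayE ` I \<union> RayF ` C)"
  shows "\<exists>c. (\<forall>F\<in>C. 0 \<le> (c F :: real)) \<and> (\<forall>i\<in>I. 0 \<le> v i) \<and>
    (\<forall>j\<in>{1..n} - I. v j = - (\<Sum>F\<in>{F\<in>C. j \<notin> F}. c F)) \<and> (\<forall>j. j \<notin> {1..n} \<longrightarrow> v j = 0)"
proof -
  obtain k where k: "\<forall>\<rho>\<in>RayE ` I \<union> RayF ` C. 0 \<le> (k \<rho> :: real)"
    and v: "v = (\<lambda>j. \<Sum>\<rho>\<in>RayE ` I \<union> RayF ` C. k \<rho> * of_int (ray_gen n \<rho> j))"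
    using v unfolding cone_of_def by blast
  have vj: "v j = (\<Sum>i\<in>I. k (RayE i) * (if j = i then 1 else 0))
      + (\<Sum>F\<in>C. k (RayF F) * (if j \<in> {1..n} - F then -1 else 0))" for j
  proof -
    have "v j = (\<Sum>\<rho>\<in>RayE ` I. k \<rho> * of_int (ray_gen n \<rho> j))
        + (\<Sum>\<rho>\<in>RayF ` C. k \<rho> * of_int (ray_gen n \<rho> j))"
      unfolding v using assms by (intro sum.union_disjoint) auto
    also have "(\<Sum>\<rho>\<in>RayE ` I. k \<rho> * of_int (ray_gen n \<rho> j))
        = (\<Sum>i\<in>I. k (RayE i) * (if j = i then 1 else 0))"
      by (subst sum.reindex) (auto simp: inj_on_def intro!: sum.cong)
    also have "(\<Sum>\<rho>\<in>RayF ` C. k \<rho> * of_int (ray_gen n \<rho> j))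
        = (\<Sum>F\<in>C. k (RayF F) * (if j \<in> {1..n} - F then -1 else 0))"
      by (subst sum.reindex) (auto simp: inj_on_def intro!: sum.cong)
    finally show ?thesis .
  qed
  have first: "(\<Sum>i\<in>I. k (RayE i) * (if j = i then 1 else 0)) = (if j \<in> I then k (RayE j) else 0)" for j
    using assms(1) by (simp add: if_distrib[where f = "\<lambda>x. _ * x"] cong: if_cong)
  have second: "(\<Sum>F\<in>C. k (RayF F) * (if j \<in> {1..n} - F then -1 else 0))
      = (if j \<in> {1..n} then - (\<Sum>F\<in>{F\<in>C. j \<notin> F}. k (RayF F)) else 0)" for j
  proof (cases "j \<in> {1..n}")
    case True
    then have "(\<Sum>F\<in>C. k (RayF F) * (if j \<in> {1..n} - F then -1 else 0))
        = (\<Sum>F\<in>C. if j \<notin> F then - k (RayF F) else 0)"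
      by (intro sum.cong) auto
    also have "\<dots> = (\<Sum>F\<in>{F\<in>C. j \<notin> F}. - k (RayF F))"
      using assms(2) by (subst sum.inter_filter) auto
    finally show ?thesis using True by (simp add: sum_negf)
  qed auto
  show ?thesis
  proof (intro exI[of _ "\<lambda>F. k (RayF F)"] conjI ballI allI impI)
    fix i assume i: "i \<in> I"
    then have "{F\<in>C. i \<notin> F} = {}" using assms by blast
    then have "v i = k (RayE i)"
      unfolding vj first second using i by (simp only: sum.empty) simp
    then show "0 \<le> v i" using k i by auto
  next
    fix j assume "j \<in> {1..n} - I"
    then show "v j = - (\<Sum>F\<in>{F\<in>C. j \<notin> F}. k (RayF F))" unfolding vj first second by simp
  next
    fix j assume "j \<notin> {1..n}"
    then show "v j = 0" unfolding vj first second using assms(3) by auto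
  qed (use k in auto)
qed

lemma face_subset:
  assumes "face r n S" "T \<subseteq> S"
  shows "face r n T"
proof -
  obtain I C where S: "S = RayE ` I \<union> RayF ` C" and I: "uniform_indep r n I"
    and C: "subset.chain {F. proper_flat r n F} C" and IC: "\<forall>F\<in>C. I \<subseteq> F"
    using assms(1) unfolding face_def by blast
  define I' C' where "I' = {i. RayE i \<in> T}" and "C' = {F. RayF F \<in> T}"
  have sub: "I' \<subseteq> I" "C' \<subseteq> C" using assms(2) S unfolding I'_def C'_def by auto
  have "T = RayE ` I' \<union> RayF ` C'"
    using assms(2) S unfolding I'_def C'_def by auto
  moreover have "uniform_indep r n I'"
    using I sub(1) unfolding uniform_indep_def
    by (meson card_mono finite_atLeastAtMost finite_subset order_trans)
  moreover have "subset.chain {F. proper_flat r n F} C'"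
    using C sub(2) unfolding subset.chain_def by blast
  ultimately show ?thesis
    using IC sub unfolding face_def by blast
qed

text \<open>A set of rays whose cone belongs to the fan consists of rays of that cone, because a generator
  of a ray of the fan that lies in a cone of the fan is one of the generators of that cone. Hence
  the monomials that are divided out are exactly those of the non-faces.\<close>

lemma cone_imp_face:
  assumes rn: "r \<le> n" and S: "S \<subseteq> rays r n" and cone: "cone_of n S \<in> aug_bergman_fan r n"
  shows "face r n S"
proof -
  obtain I C where eq: "cone_of n S = cone_of n (RayE ` I \<union> RayF ` C)" and I: "uniform_indep r n I"
    and C: "subset.chain {F. proper_flat r n F} C" and IC: "\<forall>F\<in>C. I \<subseteq> F"
    using cone unfolding aug_bergman_fan_def by blast
  have Cpf: "C \<subseteq> {F. proper_flat r n F}"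
    using C by (simp add: subset.chain_def)
  have fin: "finite I" "finite C" and In: "I \<subseteq> {1..n}"
    using I Cpf finite_proper_flats[of r n] unfolding uniform_indep_def
    by (auto intro: finite_subset)
  have finS: "finite S" using S finite_rays finite_subset by blast
  have "\<rho> \<in> RayE ` I \<union> RayF ` C" if \<rho>: "\<rho> \<in> S" for \<rho>
  proof -
    define v where "v = (\<lambda>j. of_int (ray_gen n \<rho> j) :: real)"
    have vin: "v \<in> cone_of n (RayE ` I \<union> RayF ` C)"
      using gen_in_cone[OF finS \<rho>, of n] eq unfolding v_def by simp
    obtain c where c: "\<forall>F\<in>C. 0 \<le> (c F :: real)" and vI: "\<forall>i\<in>I. 0 \<le> v i"
      and vJ': "\<forall>j\<in>{1..n} - I. v j = - (\<Sum>F\<in>{F\<in>C. j \<notin> F}. c F)"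
      and v0: "\<forall>j. j \<notin> {1..n} \<longrightarrow> v j = 0"
      using cone_coordinates[OF fin In IC vin] by auto
    note vJ = bspec[OF vJ']
    show ?thesis
    proof (cases \<rho>)
      case (RayE i)
      have "v i = 1" by (simp add: v_def RayE)
      moreover have "v i \<le> 0" if "i \<in> {1..n} - I"
        using vJ[OF that] c sum_nonneg[of "{F\<in>C. i \<notin> F}" c] by auto
      moreover have "v i = 0" if "i \<notin> {1..n}" using v0 that by blast
      ultimately have "i \<in> I" by force
      then show ?thesis using RayE by blast
    next
      case (RayF G)
      then have G: "proper_flat r n G" using S \<rho> RayF_in_rays by blast
      then obtain j0 where j0: "j0 \<in> {1..n}" "j0 \<notin> G" using proper_flat_psubset[OF rn] by blast
      have v: "v j = (if j \<in> {1..n} - G then -1 else 0)" for j by (simp add: v_def RayF)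
      have IG: "I \<subseteq> G"
      proof
        fix i assume i: "i \<in> I"
        then have "0 \<le> v i" using vI by force
        moreover have "i \<in> {1..n}" using i In by blast
        ultimately show "i \<in> G" unfolding v by (simp split: if_splits)
      qed
      \<comment> \<open>The flats that really occur contain \<open>G\<close>, and the smallest one is \<open>G\<close> itself.\<close>
      define D where "D = {F\<in>C. c F > 0}"
      have sumD: "(\<Sum>F\<in>{F\<in>D. j \<notin> F}. c F) = (\<Sum>F\<in>{F\<in>C. j \<notin> F}. c F)" for j
        using fin c unfolding D_def by (intro sum.mono_neutral_left) (auto simp: less_le)
      have sup: "G \<subseteq> F" if "F \<in> D" for F
      proof
        fix j assume j: "j \<in> G"
        show "j \<in> F"
        proof (rule ccontr)
          assume jF: "j \<notin> F"
          then have "j \<notin> I" using IC that unfolding D_def by blast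
          moreover have "j \<in> {1..n}" using j G proper_flat_subset by blast
          ultimately have "(\<Sum>F\<in>{F\<in>D. j \<notin> F}. c F) = 0"
            using vJ[of j] v[of j] j sumD[of j] by simp
          moreover have "(\<Sum>F\<in>{F\<in>D. j \<notin> F}. c F) > 0"
            using that jF fin unfolding D_def by (intro sum_pos) auto
          ultimately show False by simp
        qed
      qed
      have "D \<noteq> {}"
      proof
        assume "D = {}"
        then have "(\<Sum>F\<in>{F\<in>C. j0 \<notin> F}. c F) = 0" using sumD[of j0] by simp
        then show False using vJ[of j0] v[of j0] j0 IG by auto
      qed
      moreover have finD: "finite D" using fin D_def by simp
      ultimately obtain F0 where F0: "F0 \<in> D" and min: "\<And>F. F \<in> D \<Longrightarrow> card F0 \<le> card F"
        using arg_min_if_finite(1)[of D card] arg_min_least[of D _ card] by blast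
      have "F0 \<subseteq> F" if "F \<in> D" for F
      proof -
        have "F \<subseteq> F0 \<or> F0 \<subseteq> F" using C F0 that unfolding subset.chain_def D_def by blast
        moreover have "finite F0" using F0 Cpf finite_proper_flat unfolding D_def by blast
        ultimately show ?thesis using card_seteq[of F0 F] min[OF that] by blast
      qed
      moreover have "F0 \<subseteq> G"
      proof (rule ccontr)
        assume "\<not> F0 \<subseteq> G"
        then obtain j where j: "j \<in> F0" "j \<notin> G" by blast
        then have "{F\<in>D. j \<notin> F} = {}" using calculation by blast
        then have "(\<Sum>F\<in>{F\<in>C. j \<notin> F}. c F) = 0" using sumD[of j] by (simp only: sum.empty)
        moreover have "j \<in> {1..n}" using j(1) F0 Cpf proper_flat_subset unfolding D_def by blast
        ultimately show False using vJ[of j] v[of j] j IG by auto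
      qed
      ultimately have "G = F0" using sup F0 by blast
      then show ?thesis using F0 RayF D_def by blast
    qed
  qed
  then have "S \<subseteq> RayE ` I \<union> RayF ` C" by blast
  moreover have "face r n (RayE ` I \<union> RayF ` C)" using I C IC unfolding face_def by blast
  ultimately show ?thesis using face_subset by blast
qed

lemma cone_in_fan_iff_face:
  "r \<le> n \<Longrightarrow> S \<subseteq> rays r n \<Longrightarrow> cone_of n S \<in> aug_bergman_fan r n \<longleftrightarrow> face r n S"
  using cone_imp_face face_imp_cone by blast

lemma face_flats_comparable:
  assumes "face r n S" "RayF F \<in> S" "RayF G \<in> S"
  shows "F \<subseteq> G \<or> G \<subseteq> F"
  using assms unfolding face_def subset.chain_def by blast

lemma face_element_in_flat:
  assumes "face r n S" "RayE i \<in> S" "RayF F \<in> S"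
  shows "i \<in> F"
  using assms unfolding face_def by blast

text \<open>For \<open>r = n\<close> every subset of the ground set is independent, so that the fan is a flag
  complex.\<close>

lemma nonface_obtains_bad_pair:
  assumes S: "S \<subseteq> rays n n" and nf: "\<not> face n n S"
  obtains F G where "RayF F \<in> S" "RayF G \<in> S" "\<not> F \<subseteq> G" "\<not> G \<subseteq> F"
    | i F where "RayE i \<in> S" "RayF F \<in> S" "i \<notin> F"
proof -
  define I C where "I = {i. RayE i \<in> S}" and "C = {F. RayF F \<in> S}"
  have "S = RayE ` I \<union> RayF ` C"
    using S unfolding I_def C_def rays_def by auto
  moreover have "uniform_indep n n I"
  proof -
    have "I \<subseteq> {1..n}" using S RayE_in_rays unfolding I_def by blast
    then show ?thesis unfolding uniform_indep_def
      using card_mono[of "{1..n}" I] by simp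
  qed
  moreover have "C \<subseteq> {F. proper_flat n n F}" using S RayF_in_rays unfolding C_def by blast
  ultimately have "\<not> ((\<forall>F\<in>C. \<forall>G\<in>C. F \<subseteq> G \<or> G \<subseteq> F) \<and> (\<forall>F\<in>C. I \<subseteq> F))"
    using nf unfolding face_def subset_chain_def by metis
  then consider F G where "F \<in> C" "G \<in> C" "\<not> F \<subseteq> G" "\<not> G \<subseteq> F" | F i where "F \<in> C" "i \<in> I" "i \<notin> F"
    by blast
  then show thesis
    by cases (use that I_def C_def in auto)
qed

section \<open>The defining ideal of the augmented Chow ring\<close>

text \<open>The preimage in the polynomial ring of the zero of the augmented Chow ring, whose definition
  takes two quotients in a row.\<close>

inductive_set chow_ideal :: "nat \<Rightarrow> nat \<Rightarrow> ray mpoly set" for r n :: nat where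
  zero: "0 \<in> chow_ideal r n"
| nonface: "S \<subseteq> rays r n \<Longrightarrow> cone_of n S \<notin> aug_bergman_fan r n \<Longrightarrow> (\<Prod>\<rho>\<in>S. Var \<rho>) \<in> chow_ideal r n"
| theta: "i \<in> {1..n} \<Longrightarrow> theta r n i \<in> chow_ideal r n"
| add: "p \<in> chow_ideal r n \<Longrightarrow> q \<in> chow_ideal r n \<Longrightarrow> p + q \<in> chow_ideal r n"
| mult: "p \<in> poly_carrier (rays r n) \<Longrightarrow> q \<in> chow_ideal r n \<Longrightarrow> p * q \<in> chow_ideal r n"

lemma chow_ideal_uminus: "p \<in> chow_ideal r n \<Longrightarrow> - p \<in> chow_ideal r n"
  using chow_ideal.mult[OF poly_carrier_Const[of "-1"]] by (simp add: Const_minus)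

lemma chow_ideal_diff: "p \<in> chow_ideal r n \<Longrightarrow> q \<in> chow_ideal r n \<Longrightarrow> p - q \<in> chow_ideal r n"
  using chow_ideal.add[OF _ chow_ideal_uminus, of p r n q] by simp

lemma subspace_chow_ideal: "mp.subspace (chow_ideal r n)"
  by (intro mp.subspaceI chow_ideal.zero chow_ideal.add chow_ideal.mult poly_carrier_Const)

lemma theta_in_carrier: "theta r n i \<in> poly_carrier (rays r n)"
  unfolding theta_def
  by (intro poly_carrier_sum poly_carrier_mult poly_carrier_Const poly_carrier_Var)

lemma chow_ideal_carrier: "p \<in> chow_ideal r n \<Longrightarrow> p \<in> poly_carrier (rays r n)"
proof (induction rule: chow_ideal.induct)
  case (nonface S)
  then show ?case by (intro poly_carrier_prod poly_carrier_Var) blast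
qed (simp_all add: poly_carrier_zero poly_carrier_add poly_carrier_mult theta_in_carrier)

lemma ideal_poly_ringI:
  assumes "J \<subseteq> poly_carrier V" "0 \<in> J" "\<And>p q. p \<in> J \<Longrightarrow> q \<in> J \<Longrightarrow> p + q \<in> J"
    and mult: "\<And>p q. p \<in> poly_carrier V \<Longrightarrow> q \<in> J \<Longrightarrow> p * q \<in> J"
  shows "ideal J (poly_ring V)"
proof -
  interpret R: cring "poly_ring V" by (rule cring_poly_ring)
  have ops: "x \<oplus>\<^bsub>poly_ring V\<^esub> y = x + y" "x \<otimes>\<^bsub>poly_ring V\<^esub> y = x * y"
    "\<zero>\<^bsub>poly_ring V\<^esub> = 0" "\<one>\<^bsub>poly_ring V\<^esub> = 1" for x y
    by (simp_all add: poly_ring_def)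
  have "- x \<in> J" if "x \<in> J" for x
    using mult[OF poly_carrier_Const[of "-1"] that] by (simp add: Const_minus)
  moreover have "\<ominus>\<^bsub>poly_ring V\<^esub> x = - x" if "x \<in> poly_carrier V" for x
  proof (rule R.minus_equality)
    show "- x \<oplus>\<^bsub>poly_ring V\<^esub> x = \<zero>\<^bsub>poly_ring V\<^esub>" by (simp add: ops)
  qed (use that poly_carrier_uminus in auto)
  ultimately have inv: "\<ominus>\<^bsub>poly_ring V\<^esub> x \<in> J" if "x \<in> J" for x
    using that assms(1) by (metis subsetD)
  show ?thesis
  proof (rule idealI)
    show "subgroup J (add_monoid (poly_ring V))"
    proof (rule R.add.subgroupI)
      show "J \<noteq> {}" using assms(2) by blast
    qed (use assms inv in \<open>auto simp: ops\<close>)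
    show "x \<otimes>\<^bsub>poly_ring V\<^esub> a \<in> J" "a \<otimes>\<^bsub>poly_ring V\<^esub> x \<in> J"
      if "a \<in> J" "x \<in> carrier (poly_ring V)" for a x
      using that mult[of x a] unfolding ops by (simp_all add: mult.commute)
  qed (rule R.ring_axioms)
qed

lemma ideal_chow_ideal: "ideal (chow_ideal r n) (poly_ring (rays r n))"
  by (rule ideal_poly_ringI) (auto intro: chow_ideal_carrier chow_ideal.intros)

lemma ideal_sr_ideal: "ideal (sr_ideal r n) (poly_ring (rays r n))"
proof -
  interpret R: cring "poly_ring (rays r n)" by (rule cring_poly_ring)
  have "(\<Prod>\<rho>\<in>S. Var \<rho>) \<in> poly_carrier (rays r n)" if "S \<subseteq> rays r n" for S
    using that by (intro poly_carrier_prod poly_carrier_Var) blast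
  then show ?thesis
    unfolding sr_ideal_def by (intro R.genideal_ideal) auto
qed

lemma sr_ideal_subset: "sr_ideal r n \<subseteq> chow_ideal r n"
proof -
  interpret R: cring "poly_ring (rays r n)" by (rule cring_poly_ring)
  show ?thesis
    unfolding sr_ideal_def
    by (rule R.genideal_minimal[OF ideal_chow_ideal]) (auto intro: chow_ideal.nonface)
qed

lemma sr_class_hom: "ring_hom_ring (poly_ring (rays r n)) (sr_ring r n) (sr_class r n)"
  using ideal.rcos_ring_hom_ring[OF ideal_sr_ideal]
  unfolding sr_ring_def sr_class_def[abs_def] .

lemma sr_class_surj: "carrier (sr_ring r n) = sr_class r n ` poly_carrier (rays r n)"
  unfolding sr_ring_def sr_class_def FactRing_def A_RCOSETS_def'
  by auto

lemma cring_sr_ring: "cring (sr_ring r n)"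
  unfolding sr_ring_def by (rule ideal.quotient_is_cring[OF ideal_sr_ideal cring_poly_ring])

lemma ideal_linear_ideal: "ideal (linear_ideal r n) (sr_ring r n)"
proof -
  interpret S: cring "sr_ring r n" by (rule cring_sr_ring)
  show ?thesis
    unfolding linear_ideal_def
    using sr_class_surj theta_in_carrier by (intro S.genideal_ideal) blast
qed

lemma ideal_image_chow_ideal: "ideal (sr_class r n ` chow_ideal r n) (sr_ring r n)"
proof -
  interpret R: ring "poly_ring (rays r n)"
    using cring_poly_ring by (rule cring.axioms)
  show ?thesis
    unfolding sr_ring_def sr_class_def[abs_def]
    by (rule R.ring_ideal_imp_quot_ideal[OF ideal_sr_ideal ideal_chow_ideal])
qed

lemma chow_class_hom: "ring_hom_ring (poly_ring (rays r n)) (aug_chow_ring r n) (chow_class r n)"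
proof -
  have "ring_hom_ring (sr_ring r n) (aug_chow_ring r n) ((+>\<^bsub>sr_ring r n\<^esub>) (linear_ideal r n))"
    unfolding aug_chow_ring_def by (rule ideal.rcos_ring_hom_ring[OF ideal_linear_ideal])
  then interpret c: ring_hom_ring "sr_ring r n" "aug_chow_ring r n" "(+>\<^bsub>sr_ring r n\<^esub>) (linear_ideal r n)" .
  interpret h: ring_hom_ring "poly_ring (rays r n)" "sr_ring r n" "sr_class r n"
    by (rule sr_class_hom)
  have "((+>\<^bsub>sr_ring r n\<^esub>) (linear_ideal r n)) \<circ> sr_class r n
      \<in> ring_hom (poly_ring (rays r n)) (aug_chow_ring r n)"
    by (rule ring_hom_trans[OF h.homh c.homh])
  then show ?thesis
    by (intro ring_hom_ringI2 h.R.ring_axioms c.S.ring_axioms) (simp add: comp_def chow_class_def[abs_def])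
qed

lemma chow_class_surj: "carrier (aug_chow_ring r n) = chow_class r n ` poly_carrier (rays r n)"
  unfolding aug_chow_ring_def chow_class_def FactRing_def A_RCOSETS_def'
  by (auto simp: sr_class_surj)

lemma chow_class_eq_iff:
  assumes p: "p \<in> poly_carrier (rays r n)" and q: "q \<in> poly_carrier (rays r n)"
  shows "chow_class r n p = chow_class r n q \<longleftrightarrow> p - q \<in> chow_ideal r n"
proof -
  let ?R = "poly_ring (rays r n)" and ?S = "sr_ring r n" and ?A = "aug_chow_ring r n"
  interpret R: cring ?R by (rule cring_poly_ring)
  interpret S: cring ?S by (rule cring_sr_ring)
  interpret h: ring_hom_ring ?R ?S "sr_class r n" by (rule sr_class_hom)
  interpret c: ring_hom_ring ?R ?A "chow_class r n" by (rule chow_class_hom)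
  have ops: "x \<oplus>\<^bsub>?R\<^esub> y = x + y" "x \<otimes>\<^bsub>?R\<^esub> y = x * y" "\<zero>\<^bsub>?R\<^esub> = 0" for x y
    by (simp_all add: poly_ring_def)
  have zero_iff: "sr_class r n f \<in> linear_ideal r n \<longleftrightarrow> f \<in> chow_ideal r n"
    if f: "f \<in> poly_carrier (rays r n)" for f
  proof
    assume "f \<in> chow_ideal r n"
    then show "sr_class r n f \<in> linear_ideal r n"
    proof (induction rule: chow_ideal.induct)
      case zero
      then show ?case
        using h.hom_zero additive_subgroup.zero_closed[OF ideal.axioms(1)[OF ideal_linear_ideal]]
        unfolding ops by simp
    next
      case (nonface S)
      then have "(\<Prod>\<rho>\<in>S. Var \<rho>) \<in> sr_ideal r n"
        using R.genideal_self unfolding sr_ideal_def genideal_def by blast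
      then have "sr_class r n (\<Prod>\<rho>\<in>S. Var \<rho>) = \<zero>\<^bsub>?S\<^esub>"
        using R.a_rcos_zero[OF ideal_sr_ideal] unfolding sr_class_def
        by (simp add: sr_ring_def FactRing_def)
      then show ?case
        using additive_subgroup.zero_closed[OF ideal.axioms(1)[OF ideal_linear_ideal]] by simp
    next
      case (theta i)
      then show ?case unfolding linear_ideal_def genideal_def by blast
    next
      case (add p q)
      then show ?case
        using h.hom_add[of p q] chow_ideal_carrier
          additive_subgroup.a_closed[OF ideal.axioms(1)[OF ideal_linear_ideal]]
        unfolding ops by simp
    next
      case (mult p q)
      then show ?case
        using h.hom_mult[of p q] chow_ideal_carrier ideal.I_l_closed[OF ideal_linear_ideal]
          h.hom_closed[of p]
        unfolding ops by simp
    qed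
  next
    assume "sr_class r n f \<in> linear_ideal r n"
    moreover have "linear_ideal r n \<subseteq> sr_class r n ` chow_ideal r n"
      unfolding linear_ideal_def
      by (rule S.genideal_minimal[OF ideal_image_chow_ideal]) (use chow_ideal.theta in blast)
    ultimately obtain g where g: "g \<in> chow_ideal r n" "sr_class r n f = sr_class r n g" by blast
    then have "f \<ominus>\<^bsub>?R\<^esub> g \<in> sr_ideal r n"
      using R.quotient_eq_iff_same_a_r_cos[OF ideal_sr_ideal, of f g] f chow_ideal_carrier
      unfolding sr_class_def by simp
    then have "f \<ominus>\<^bsub>?R\<^esub> g \<in> chow_ideal r n" using sr_ideal_subset by blast
    then have "(f \<ominus>\<^bsub>?R\<^esub> g) \<oplus>\<^bsub>?R\<^esub> g \<in> chow_ideal r n" using g chow_ideal.add ops by simp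
    moreover have "(f \<ominus>\<^bsub>?R\<^esub> g) \<oplus>\<^bsub>?R\<^esub> g = f"
      using f chow_ideal_carrier[OF g(1)] unfolding carrier_poly_ring[symmetric]
      by (simp add: R.minus_eq R.a_assoc R.l_neg del: carrier_poly_ring)
    ultimately show "f \<in> chow_ideal r n" by simp
  qed
  have pq: "p - q \<in> poly_carrier (rays r n)" using p q poly_carrier_diff by blast
  have split: "p = (p - q) \<oplus>\<^bsub>?R\<^esub> q" by (simp add: ops)
  have "sr_class r n p = sr_class r n (p - q) \<oplus>\<^bsub>?S\<^esub> sr_class r n q"
    using h.hom_add[of "p - q" q] pq q split by simp
  then have "sr_class r n p \<ominus>\<^bsub>?S\<^esub> sr_class r n q = sr_class r n (p - q)"
    using h.hom_closed pq q by (simp add: S.minus_eq S.a_assoc S.r_neg)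
  then show ?thesis
    using S.quotient_eq_iff_same_a_r_cos[OF ideal_linear_ideal, of "sr_class r n p" "sr_class r n q"]
      zero_iff[OF pq] h.hom_closed p q
    unfolding chow_class_def by simp
qed

section \<open>Spanning by straightening\<close>

abbreviation xvar :: "nat set \<Rightarrow> ray mpoly" where "xvar F \<equiv> Var (RayF F)"
abbreviation yvar :: "nat \<Rightarrow> ray mpoly" where "yvar i \<equiv> Var (RayE i)"

definition flat_chain :: "nat \<Rightarrow> nat \<Rightarrow> nat set set \<Rightarrow> bool" where
  "flat_chain r n C \<longleftrightarrow> C \<noteq> {} \<and> (\<forall>F\<in>C. proper_flat r n F) \<and> (\<forall>F\<in>C. \<forall>G\<in>C. F \<subseteq> G \<or> G \<subseteq> F)"

definition chain_monomial :: "nat set set \<Rightarrow> ray mpoly" where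
  "chain_monomial C = (\<Prod>F\<in>C. xvar F)"

definition avoiding_sum :: "nat \<Rightarrow> nat \<Rightarrow> nat \<Rightarrow> ray mpoly" where
  "avoiding_sum r n i = (\<Sum>F\<in>{F. proper_flat r n F \<and> i \<notin> F}. xvar F)"

lemma finite_flat_chain: "flat_chain r n C \<Longrightarrow> finite C"
  by (rule finite_subset[OF _ finite_proper_flats]) (auto simp: flat_chain_def)

lemma flat_chain_proper: "flat_chain r n C \<Longrightarrow> F \<in> C \<Longrightarrow> proper_flat r n F"
  by (simp add: flat_chain_def)

lemma chain_monomial_remove:
  "finite C \<Longrightarrow> F \<in> C \<Longrightarrow> chain_monomial C = xvar F * chain_monomial (C - {F})"
  unfolding chain_monomial_def by (rule prod.remove)

lemma chain_monomial_insert: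
  "finite C \<Longrightarrow> F \<notin> C \<Longrightarrow> chain_monomial (insert F C) = xvar F * chain_monomial C"
  unfolding chain_monomial_def by simp

lemma xvar_carrier: "proper_flat r n F \<Longrightarrow> xvar F \<in> poly_carrier (rays r n)"
  by (intro poly_carrier_Var) (simp add: RayF_in_rays)

lemma chain_monomial_carrier:
  "(\<And>F. F \<in> C \<Longrightarrow> proper_flat r n F) \<Longrightarrow> chain_monomial C \<in> poly_carrier (rays r n)"
  unfolding chain_monomial_def by (intro poly_carrier_prod xvar_carrier)

lemma xvars_carrier:
  "(\<And>G. G \<in> set L \<Longrightarrow> proper_flat r n G) \<Longrightarrow> (\<Prod>G\<leftarrow>L. xvar G) \<in> poly_carrier (rays r n)"
  by (induct L) (simp_all add: poly_carrier_one poly_carrier_mult xvar_carrier)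

lemma theta_eq:
  assumes i: "i \<in> {1..n}" and r: "1 \<le> r"
  shows "theta r n i = yvar i - avoiding_sum r n i"
proof -
  have R: "rays r n = RayE ` {1..n} \<union> RayF ` {F. proper_flat r n F}"
    using r by (auto simp: rays_def uniform_indep_def)
  have "theta r n i = (\<Sum>\<rho>\<in>RayE ` {1..n}. Const (of_int (ray_gen n \<rho> i)) * Var \<rho>)
      + (\<Sum>\<rho>\<in>RayF ` {F. proper_flat r n F}. Const (of_int (ray_gen n \<rho> i)) * Var \<rho>)"
    unfolding theta_def R using finite_proper_flats by (intro sum.union_disjoint) auto
  also have "(\<Sum>\<rho>\<in>RayE ` {1..n}. Const (of_int (ray_gen n \<rho> i)) * Var \<rho>)
      = (\<Sum>j\<in>{1..n}. Const (of_int (ray_gen n (RayE j) i)) * yvar j)"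
    by (subst sum.reindex) (simp_all add: inj_on_def)
  also have "\<dots> = (\<Sum>j\<in>{1..n}. if i = j then yvar j else 0)"
    by (intro sum.cong) auto
  also have "\<dots> = yvar i" using i by simp
  also have "(\<Sum>\<rho>\<in>RayF ` {F. proper_flat r n F}. Const (of_int (ray_gen n \<rho> i)) * Var \<rho>)
      = (\<Sum>F\<in>{F. proper_flat r n F}. if i \<notin> F then - xvar F else 0)"
    using i by (subst sum.reindex) (auto simp: inj_on_def Const_minus intro!: sum.cong)
  also have "\<dots> = (\<Sum>F\<in>{F. proper_flat r n F \<and> i \<notin> F}. - xvar F)"
    using finite_proper_flats[of r n] by (simp add: sum.inter_filter[symmetric])
  finally show ?thesis by (simp add: sum_negf avoiding_sum_def)
qed

lemma incomparable_in_chow_ideal: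
  assumes "r \<le> n" "proper_flat r n F" "proper_flat r n G" "\<not> F \<subseteq> G" "\<not> G \<subseteq> F"
  shows "xvar F * xvar G \<in> chow_ideal r n"
proof -
  have "{RayF F, RayF G} \<subseteq> rays r n" using assms by (simp add: RayF_in_rays)
  moreover have "\<not> face r n {RayF F, RayF G}" using assms face_flats_comparable by blast
  ultimately have "(\<Prod>\<rho>\<in>{RayF F, RayF G}. Var \<rho>) \<in> chow_ideal r n"
    using assms(1) by (intro chow_ideal.nonface) (simp_all add: cone_in_fan_iff_face)
  moreover have "F \<noteq> G" using assms by blast
  ultimately show ?thesis by simp
qed

lemma yvar_xvar_in_chow_ideal:
  assumes "r \<le> n" "proper_flat r n F" "i \<in> {1..n}" "i \<notin> F"
  shows "xvar F * yvar i \<in> chow_ideal r n"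
proof -
  have "1 \<le> r" using assms(2) by (simp add: proper_flat_def)
  then have "{RayF F, RayE i} \<subseteq> rays r n" using assms by (simp add: RayF_in_rays RayE_in_rays)
  moreover have "\<not> face r n {RayF F, RayE i}" using assms face_element_in_flat by blast
  ultimately have "(\<Prod>\<rho>\<in>{RayF F, RayE i}. Var \<rho>) \<in> chow_ideal r n"
    using assms(1) by (intro chow_ideal.nonface) (simp_all add: cone_in_fan_iff_face)
  then show ?thesis by simp
qed

text \<open>The linear forms turn \<open>y\<^sub>i\<close> into the sum of the \<open>x\<^bsub>G\<^esub>\<close> with \<open>i \<notin> G\<close>. So the products
  \<open>x\<^bsub>F\<^esub> y\<^sub>i\<close> with \<open>i \<notin> F\<close> become quadratic relations among the variables of the flats. These
  and the products of incomparable flats are the relations that the straightening uses.\<close>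

lemma xvar_avoiding_in_chow_ideal:
  assumes "r \<le> n" "proper_flat r n F" "i \<in> {1..n}" "i \<notin> F"
  shows "xvar F * avoiding_sum r n i \<in> chow_ideal r n"
proof -
  have "1 \<le> r" using assms(2) by (simp add: proper_flat_def)
  then have "avoiding_sum r n i = yvar i - theta r n i"
    using theta_eq[OF assms(3), of r] by simp
  then have "xvar F * avoiding_sum r n i = xvar F * yvar i - xvar F * theta r n i"
    by (simp add: right_diff_distrib)
  then show ?thesis
    using yvar_xvar_in_chow_ideal[OF assms] assms(2,3)
    by (simp add: chow_ideal_diff chow_ideal.mult chow_ideal.theta xvar_carrier)
qed

lemma chain_monomial_avoiding_in_chow_ideal:
  assumes "r \<le> n" "finite C" "\<And>G. G \<in> C \<Longrightarrow> proper_flat r n G" "F \<in> C" "i \<in> {1..n}" "i \<notin> F"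
  shows "chain_monomial C * avoiding_sum r n i \<in> chow_ideal r n"
proof -
  have "chain_monomial (C - {F}) * (xvar F * avoiding_sum r n i) \<in> chow_ideal r n"
    using assms
    by (intro chow_ideal.mult chain_monomial_carrier xvar_avoiding_in_chow_ideal) auto
  then show ?thesis
    using chain_monomial_remove[OF assms(2,4)] by (simp add: mult_ac)
qed

lemma chain_monomial_incomparable_in_chow_ideal:
  assumes "r \<le> n" "finite C" "\<And>G. G \<in> C \<Longrightarrow> proper_flat r n G" "F \<in> C"
    and "proper_flat r n H" "\<not> F \<subseteq> H" "\<not> H \<subseteq> F"
  shows "chain_monomial C * xvar H \<in> chow_ideal r n"
proof -
  have "chain_monomial (C - {F}) * (xvar F * xvar H) \<in> chow_ideal r n"
    using assms
    by (intro chow_ideal.mult chain_monomial_carrier incomparable_in_chow_ideal) auto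
  then show ?thesis
    using chain_monomial_remove[OF assms(2,4)] by (simp add: mult_ac)
qed

text \<open>Powers disappear: if \<open>i\<close> is an element of the successor of \<open>G\<close> in the chain that is not in
  \<open>G\<close>, then the members of the chain avoiding \<open>i\<close> are those up to \<open>G\<close>. So the relation of \<open>i\<close>
  expresses \<open>x\<^bsub>C\<^esub> x\<^bsub>G\<^esub>\<close> by products of \<open>x\<^bsub>C\<^esub>\<close> with variables outside the chain and with
  members of the chain below \<open>G\<close>. The chain only grows, so that a member with at least \<open>t\<close>
  elements stays.\<close>

lemma chain_monomial_times_flats:
  assumes rn: "r \<le> n" and S: "mp.subspace S" "chow_ideal r n \<subseteq> S"
    and sqfree: "\<And>C. flat_chain r n C \<Longrightarrow> \<exists>F\<in>C. t \<le> card F \<Longrightarrow> chain_monomial C \<in> S"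
    and C: "flat_chain r n C" "\<exists>F\<in>C. t \<le> card F"
    and L: "\<forall>G\<in>set L. proper_flat r n G"
  shows "chain_monomial C * (\<Prod>G\<leftarrow>L. xvar G) \<in> S"
  using L C
proof (induction L arbitrary: C)
  case Nil
  then show ?case using sqfree by simp
next
  case (Cons G L)
  let ?L = "\<Prod>G\<leftarrow>L. xvar G"
  have finC: "finite C" using Cons.prems(2) finite_flat_chain by blast
  have Lc: "?L \<in> poly_carrier (rays r n)" using Cons.prems(1) by (intro xvars_carrier) simp
  have outside: "chain_monomial C * xvar H * ?L \<in> S" if H: "proper_flat r n H" "H \<notin> C" for H
  proof (cases "\<forall>F\<in>C. F \<subseteq> H \<or> H \<subseteq> F")
    case True
    then have "flat_chain r n (insert H C)"
      using H Cons.prems(2) unfolding flat_chain_def by blast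
    then have "chain_monomial (insert H C) * ?L \<in> S"
      using Cons.prems by (intro Cons.IH) auto
    then show ?thesis using chain_monomial_insert[OF finC H(2)] by (simp add: mult_ac)
  next
    case False
    then obtain F where "F \<in> C" "\<not> F \<subseteq> H" "\<not> H \<subseteq> F" by blast
    then have "chain_monomial C * xvar H \<in> chow_ideal r n"
      using chain_monomial_incomparable_in_chow_ideal[OF rn finC] H(1) Cons.prems(2) flat_chain_proper
      by blast
    then have "?L * (chain_monomial C * xvar H) \<in> chow_ideal r n"
      using Lc chow_ideal.mult by blast
    then show ?thesis using S(2) by (simp add: mult_ac subset_iff)
  qed
  have inside: "chain_monomial C * xvar H * ?L \<in> S" if "H \<in> C" for H
    using that
  proof (induction "card H" arbitrary: H rule: less_induct)
    case less
    have Hp: "proper_flat r n H" using less.prems Cons.prems(2) flat_chain_proper by blast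
    obtain i where i: "i \<in> {1..n}" "i \<notin> H" "\<forall>K\<in>C. H \<subset> K \<longrightarrow> i \<in> K"
    proof (cases "\<exists>K\<in>C. H \<subset> K")
      case True
      then obtain K where K: "K \<in> C \<and> H \<subset> K"
        and least: "\<And>K'. K' \<in> C \<and> H \<subset> K' \<Longrightarrow> card K \<le> card K'"
        using exists_least_iff[of "\<lambda>k. \<exists>K. (K \<in> C \<and> H \<subset> K) \<and> card K = k"]
        by (metis (no_types, lifting) linorder_not_le)
      then obtain i where i: "i \<in> K" "i \<notin> H" by blast
      have "i \<in> K'" if K': "K' \<in> C" "H \<subset> K'" for K'
      proof -
        have "K \<subseteq> K' \<or> K' \<subseteq> K" using K K' Cons.prems(2) unfolding flat_chain_def by blast
        moreover have "finite K" using K Cons.prems(2) flat_chain_proper finite_proper_flat by blast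
        ultimately have "K \<subseteq> K'" using least[of K'] K' card_seteq[of K K'] by blast
        then show ?thesis using i by blast
      qed
      moreover have "i \<in> {1..n}"
        using i K Cons.prems(2) flat_chain_proper proper_flat_subset by blast
      ultimately show thesis using i that by blast
    next
      case False
      then show thesis using proper_flat_psubset[OF rn Hp] that by blast
    qed
    let ?A = "{K. proper_flat r n K \<and> i \<notin> K}"
    have finA: "finite ?A" using finite_proper_flats by (rule rev_finite_subset) blast
    have HA: "H \<in> ?A" using Hp i by blast
    have others: "chain_monomial C * xvar K * ?L \<in> S" if K: "K \<in> ?A - {H}" for K
    proof (cases "K \<in> C")
      case True
      have "\<not> H \<subset> K" using K i True by blast
      moreover have "H \<subseteq> K \<or> K \<subseteq> H"
        using True less.prems Cons.prems(2) unfolding flat_chain_def by blast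
      ultimately have "K \<subset> H" using K by blast
      then have "card K < card H" using Hp finite_proper_flat psubset_card_mono by blast
      then show ?thesis using less.hyps True by blast
    next
      case False
      then show ?thesis using K outside by blast
    qed
    have "?L * (chain_monomial C * avoiding_sum r n i) \<in> chow_ideal r n"
      using chain_monomial_avoiding_in_chow_ideal[OF rn finC _ less.prems i(1,2)]
        Cons.prems(2) flat_chain_proper Lc chow_ideal.mult by blast
    moreover have "?L * (chain_monomial C * avoiding_sum r n i)
        = chain_monomial C * xvar H * ?L + (\<Sum>K\<in>?A - {H}. chain_monomial C * xvar K * ?L)"
      unfolding avoiding_sum_def sum.remove[OF finA HA]
      by (simp add: algebra_simps sum_distrib_left sum_distrib_right)
    ultimately have "chain_monomial C * xvar H * ?L
        + (\<Sum>K\<in>?A - {H}. chain_monomial C * xvar K * ?L) \<in> S"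
      using S(2) by auto
    moreover have "(\<Sum>K\<in>?A - {H}. chain_monomial C * xvar K * ?L) \<in> S"
      using others by (intro mp.subspace_sum[OF S(1)])
    ultimately show ?case using mp.subspace_diff[OF S(1)] by fastforce
  qed
  show ?case
    using inside[of G] outside[of G] Cons.prems(1) by (cases "G \<in> C") (simp_all add: mult_ac)
qed

lemma sorted_flag_of_chain:
  assumes "finite C" "\<forall>F\<in>C. finite F" "\<forall>F\<in>C. \<forall>G\<in>C. F \<subseteq> G \<or> G \<subseteq> (F :: 'a set)"
  shows "\<exists>fl. set fl = C \<and> sorted_wrt (\<subset>) fl"
proof -
  obtain xs where xs: "set xs = C" "distinct xs" using finite_distinct_list[OF assms(1)] by blast
  define fl where "fl = sort_key card xs"
  have fl: "set fl = C" "distinct fl" "sorted (map card fl)" using xs by (simp_all add: fl_def)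
  have "fl ! i \<subset> fl ! j" if ij: "i < j" "j < length fl" for i j
  proof -
    have "card (fl ! i) \<le> card (fl ! j)"
      using fl(3) ij by (simp add: sorted_iff_nth_mono_less)
    moreover have "fl ! i \<noteq> fl ! j" using fl(2) ij by (simp add: nth_eq_iff_index_eq)
    moreover have "fl ! i \<in> C" "fl ! j \<in> C" using ij fl(1) by auto
    ultimately show ?thesis
      using assms(2,3) card_seteq[of "fl ! i" "fl ! j"] by blast
  qed
  then have "sorted_wrt (\<subset>) fl" by (simp add: sorted_wrt_iff_nth_less)
  then show ?thesis using fl(1) by blast
qed

text \<open>The failure of retrality, phrased without the order of the flag: \<open>Q\<close> and \<open>Q \<union> {i}\<close> are
  then consecutive members of the chain, and \<open>j\<close> shows that \<open>i\<close> is not the maximum of the two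
  blocks after \<open>Q\<close>.\<close>

definition reducible :: "nat \<Rightarrow> nat set set \<Rightarrow> bool" where
  "reducible n C \<longleftrightarrow> (\<exists>Q i j. Q \<in> C \<and> insert i Q \<in> C \<and> i \<notin> Q \<and> i < j \<and> j \<in> {1..n} \<and> j \<notin> Q \<and>
     (\<forall>H\<in>C. insert i Q \<subset> H \<longrightarrow> j \<in> H))"

lemma irreducible_imp_retral:
  assumes rn: "r \<le> n" and C: "flat_chain r n C" and irr: "\<not> reducible n C"
    and fl: "set fl = C" "sorted_wrt (\<subset>) fl"
  shows "retral r n (hd fl) fl"
proof -
  define G where "G = (\<lambda>k. (fl @ [{1..n}]) ! k)"
  have ord: "fl ! a \<subset> fl ! b" if "a < b" "b < length fl" for a b
    using fl(2) that by (rule sorted_wrt_nth_less)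
  have flag: "contraction_flag r n (hd fl) fl"
    using C fl unfolding contraction_flag_def flat_chain_def by auto
  have "G k - G (k - 1) = {Max (G (k + 1) - G (k - 1))}"
    if k: "1 \<le> k" "k < length fl" "card (G k - G (k - 1)) = 1" for k
  proof (rule ccontr)
    assume neq: "G k - G (k - 1) \<noteq> {Max (G (k + 1) - G (k - 1))}"
    define Q F N where "Q = G (k - 1)" and "F = G k" and "N = G (k + 1)"
    have Q: "Q = fl ! (k - 1)" and F: "F = fl ! k"
      using k by (auto simp: Q_def F_def G_def nth_append)
    have QC: "Q \<in> C" and FC: "F \<in> C" using k fl(1) unfolding Q F by auto
    have QF: "Q \<subset> F" using k unfolding Q F by (intro ord) simp_all
    have N: "N = (if k + 1 < length fl then fl ! (k + 1) else {1..n})"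
      using k by (auto simp: N_def G_def nth_append)
    have FN: "F \<subset> N"
      using ord[of k "k + 1"] proper_flat_psubset[OF rn flat_chain_proper[OF C FC]]
      unfolding N F by simp
    have Nn: "N \<subseteq> {1..n}"
    proof (cases "k + 1 < length fl")
      case True
      then have "N \<in> C" using fl(1) N by auto
      then show ?thesis using C flat_chain_proper proper_flat_subset by blast
    qed (simp add: N)
    obtain i where i: "F - Q = {i}" using k(3) card_1_singletonE unfolding Q_def F_def by metis
    define j where "j = Max (N - Q)"
    have fin: "finite (N - Q)" using Nn finite_subset by blast
    have iN: "i \<in> N - Q" using i FN by blast
    have jN: "j \<in> N - Q" using fin iN Max_in unfolding j_def by blast
    have "i \<le> j" using fin iN unfolding j_def by simp
    moreover have "i \<noteq> j" using neq i unfolding j_def Q_def F_def N_def by auto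
    ultimately have "i < j" by simp
    moreover have "insert i Q = F" using i QF by blast
    moreover have "j \<in> H" if H: "H \<in> C" "F \<subset> H" for H
    proof -
      obtain m where m: "m < length fl" "H = fl ! m" using H(1) fl(1) by (metis in_set_conv_nth)
      have "\<not> m \<le> k"
      proof
        assume "m \<le> k"
        then have "H \<subseteq> F" using ord[of m k] k m unfolding F by (cases "m = k") auto
        then show False using H by blast
      qed
      then have "N \<subseteq> H" using ord[of "k + 1" m] m unfolding N by (cases "m = k + 1") auto
      then show ?thesis using jN by blast
    qed
    ultimately have "reducible n C"
      unfolding reducible_def using QC FC jN Nn iN by blast
    then show False using irr by blast
  qed
  then show ?thesis unfolding retral_def Let_def G_def[symmetric] using flag by blast
qed

text \<open>Straightening of square-free monomials: a reducible member \<open>F = Q \<union> {i}\<close> of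
  the chain is traded, through the difference of the relations of \<open>i\<close> and \<open>j\<close>, for proper supersets
  of \<open>F\<close> and for supersets of \<open>Q \<union> {j}\<close>. Both have a larger sum of elements than \<open>F\<close>, so
  that the process ends, and at least as many elements, so that the bound \<open>t\<close> survives.\<close>

lemma chain_monomial_in_subspace:
  assumes rn: "r \<le> n" and S: "mp.subspace S" "chow_ideal r n \<subseteq> S"
    and ret: "\<And>fl. retral r n (hd fl) fl \<Longrightarrow> \<exists>F\<in>set fl. t \<le> card F \<Longrightarrow> chain_monomial (set fl) \<in> S"
    and C: "flat_chain r n C" "\<exists>F\<in>C. t \<le> card F"
  shows "chain_monomial C \<in> S"
  using C
proof (induction "card C * \<Sum>{1..n} - (\<Sum>F\<in>C. \<Sum>F)" arbitrary: C rule: less_induct)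
  case less
  have finC: "finite C" using less.prems finite_flat_chain by blast
  have proper: "proper_flat r n F" if "F \<in> C" for F using that less.prems flat_chain_proper by blast
  show ?case
  proof (cases "reducible n C")
    case False
    obtain fl where fl: "set fl = C" "sorted_wrt (\<subset>) fl"
      using sorted_flag_of_chain[of C] finC finite_proper_flat[of r n] less.prems(1)
      unfolding flat_chain_def by auto
    then show ?thesis
      using ret[OF irreducible_imp_retral[OF rn less.prems(1) False fl]] less.prems(2) by simp
  next
    case True
    then obtain Q i j where Q: "Q \<in> C" and FC: "insert i Q \<in> C" and iQ: "i \<notin> Q" and ij: "i < j"
      and jn: "j \<in> {1..n}" and jQ: "j \<notin> Q" and up: "\<forall>H\<in>C. insert i Q \<subset> H \<longrightarrow> j \<in> H"
      unfolding reducible_def by blast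
    define F R where "F = insert i Q" and "R = C - {F}"
    have finQ: "finite Q" using Q proper finite_proper_flat by blast
    have FC: "F \<in> C" using FC F_def by simp
    have in1: "i \<in> {1..n}" using proper[OF FC] proper_flat_subset F_def by blast
    have finR: "finite R" using finC R_def by simp
    have QR: "Q \<in> R" using Q iQ unfolding R_def F_def by blast
    have properR: "proper_flat r n H" if "H \<in> R" for H using that proper R_def by blast
    have jF: "j \<notin> F" using jQ ij F_def by blast
    have replace: "chain_monomial R * xvar H \<in> S"
      if H: "proper_flat r n H" "H \<notin> R" and heavier: "Q \<subseteq> H \<Longrightarrow> \<Sum>F < \<Sum>H \<and> card F \<le> card H"
        and notbelow: "\<not> H \<subseteq> Q" for H
    proof (cases "\<forall>K\<in>R. K \<subseteq> H \<or> H \<subseteq> K")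
      case False
      then obtain K where "K \<in> R" "\<not> K \<subseteq> H" "\<not> H \<subseteq> K" by blast
      then show ?thesis
        using chain_monomial_incomparable_in_chow_ideal[OF rn finR properR _ H(1)] S(2) by blast
    next
      case True
      then have QH: "Q \<subseteq> H" using QR notbelow by blast
      define C' where "C' = insert H R"
      have C': "flat_chain r n C'"
        using True H less.prems(1) unfolding C'_def R_def flat_chain_def by blast
      have cardC': "card C' = card C"
        using card_insert_disjoint[OF finR H(2)] card_Suc_Diff1[OF finC FC]
        unfolding C'_def R_def by simp
      have sumC: "(\<Sum>K\<in>C. \<Sum>K) = \<Sum>F + (\<Sum>K\<in>R. \<Sum>K)"
        unfolding R_def using finC FC by (rule sum.remove)
      have sumC': "(\<Sum>K\<in>C'. \<Sum>K) = \<Sum>H + (\<Sum>K\<in>R. \<Sum>K)"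
        unfolding C'_def using finR H(2) by simp
      have "(\<Sum>K\<in>C'. \<Sum>K) \<le> (\<Sum>K\<in>C'. \<Sum>{1..n})"
      proof (rule sum_mono)
        fix K assume "K \<in> C'"
        then have "K \<subseteq> {1..n}" using C' flat_chain_proper proper_flat_subset by blast
        then show "\<Sum>K \<le> \<Sum>{1..n}" by (intro sum_mono2) simp_all
      qed
      then have "card C' * \<Sum>{1..n} - (\<Sum>K\<in>C'. \<Sum>K) < card C * \<Sum>{1..n} - (\<Sum>K\<in>C. \<Sum>K)"
        using conjunct1[OF heavier[OF QH]] sumC sumC' cardC'
          diff_less_mono2[of "\<Sum>K\<in>C. \<Sum>K" "\<Sum>K\<in>C'. \<Sum>K" "card C * \<Sum>{1..n}"] by simp
      moreover have "\<exists>K\<in>C'. t \<le> card K"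
        using less.prems(2) heavier[OF QH] unfolding C'_def R_def by (metis DiffI empty_iff insertE insertI1 insertI2 order_trans)
      ultimately have "chain_monomial C' \<in> S" using less.hyps C' by blast
      then show ?thesis unfolding C'_def chain_monomial_insert[OF finR H(2)] by (simp add: mult_ac)
    qed
    \<comment> \<open>\<open>?I\<close> and \<open>?J\<close> index what is left of the difference of the relations of \<open>j\<close> and \<open>i\<close>.\<close>
    let ?I = "{H. proper_flat r n H \<and> i \<in> H \<and> j \<notin> H}" and ?J = "{H. proper_flat r n H \<and> j \<in> H \<and> i \<notin> H}"
    let ?N = "{H. proper_flat r n H \<and> i \<notin> H \<and> j \<notin> H}"
    have fins: "finite ?I" "finite ?J" "finite ?N"
      by (rule finite_subset[OF _ finite_proper_flats[of r n]], blast)+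
    have FI: "F \<in> ?I" using FC proper jF F_def by blast
    have stepI: "chain_monomial R * xvar H \<in> S" if H: "H \<in> ?I - {F}" for H
    proof (rule replace)
      show "H \<notin> R"
      proof
        assume HR: "H \<in> R"
        then have "Q \<subseteq> H \<or> H \<subseteq> Q" using QR less.prems(1) unfolding R_def flat_chain_def by blast
        then have "F \<subset> H" using H iQ unfolding F_def by blast
        then show False using up HR H unfolding R_def F_def by blast
      qed
      show "\<Sum>F < \<Sum>H \<and> card F \<le> card H" if "Q \<subseteq> H"
      proof -
        have FH: "F \<subset> H" using that H unfolding F_def by blast
        have finH: "finite H" using H finite_proper_flat by blast
        obtain k where k: "k \<in> H - F" using FH by blast
        then have "1 \<le> k" using H proper_flat_subset by fastforce
        have "\<Sum>F + k = \<Sum>(insert k F)" using k finQ F_def by simp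
        also have "\<dots> \<le> \<Sum>H" using k FH finH by (intro sum_mono2) auto
        finally show ?thesis using \<open>1 \<le> k\<close> card_mono[OF finH, of F] FH by auto
      qed
    qed (use H iQ in auto)
    have stepJ: "chain_monomial R * xvar H \<in> S" if H: "H \<in> ?J" for H
    proof (rule replace)
      show "H \<notin> R"
      proof
        assume HR: "H \<in> R"
        then have "F \<subseteq> H \<or> H \<subseteq> F" using FC less.prems(1) unfolding R_def flat_chain_def by blast
        then show False using H jF unfolding F_def by blast
      qed
      show "\<Sum>F < \<Sum>H \<and> card F \<le> card H" if "Q \<subseteq> H"
      proof -
        have finH: "finite H" using H finite_proper_flat by blast
        have sub: "insert j Q \<subseteq> H" using that H by blast
        have "\<Sum>F < \<Sum>(insert j Q)" using finQ iQ jQ ij unfolding F_def by simp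
        also have "\<dots> \<le> \<Sum>H" using sub finH by (intro sum_mono2) auto
        finally show ?thesis
          using card_mono[OF finH sub] finQ iQ jQ unfolding F_def by simp
      qed
    qed (use H jQ in auto)
    have avj: "avoiding_sum r n j = (\<Sum>H\<in>?N. xvar H) + (\<Sum>H\<in>?I. xvar H)"
      unfolding avoiding_sum_def using fins
      by (subst sum.union_disjoint[symmetric]) (auto intro!: arg_cong2[of _ _ _ _ sum])
    have avi: "avoiding_sum r n i = (\<Sum>H\<in>?N. xvar H) + (\<Sum>H\<in>?J. xvar H)"
      unfolding avoiding_sum_def using fins
      by (subst sum.union_disjoint[symmetric]) (auto intro!: arg_cong2[of _ _ _ _ sum])
    have rel: "chain_monomial R * avoiding_sum r n k \<in> S" if "k \<in> {i, j}" for k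
      using chain_monomial_avoiding_in_chow_ideal[OF rn finR properR QR, of k] that S(2) in1 jn iQ jQ by blast
    have "chain_monomial C = chain_monomial R * xvar F"
      using chain_monomial_remove[OF finC FC] unfolding R_def by (simp add: mult_ac)
    also have "\<dots> = chain_monomial R * avoiding_sum r n j - chain_monomial R * avoiding_sum r n i
        - (\<Sum>H\<in>?I - {F}. chain_monomial R * xvar H) + (\<Sum>H\<in>?J. chain_monomial R * xvar H)"
      unfolding avj avi sum.remove[OF fins(1) FI]
      by (simp add: algebra_simps sum_distrib_left)
    also have "\<dots> \<in> S"
      using rel stepI stepJ
      by (intro mp.subspace_add[OF S(1)] mp.subspace_diff[OF S(1)] mp.subspace_sum[OF S(1)]) auto
    finally show ?thesis .
  qed
qed

text \<open>The variables \<open>y\<^sub>i\<close> are eliminated by the linear forms. The list \<open>L\<close> in the proof collects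
  the variables of flats that appear in this way.\<close>

lemma xvar_multiple_in_subspace:
  assumes rn: "r \<le> n" and S: "mp.subspace S" "chow_ideal r n \<subseteq> S"
    and ret: "\<And>fl. retral r n (hd fl) fl \<Longrightarrow> \<exists>F\<in>set fl. t \<le> card F \<Longrightarrow> chain_monomial (set fl) \<in> S"
    and F: "proper_flat r n F" "t \<le> card F" and p: "p \<in> poly_carrier (rays r n)"
  shows "xvar F * p \<in> S"
proof -
  have "xvar F * (\<Prod>G\<leftarrow>L. xvar G) * p \<in> S" if L: "\<forall>G\<in>set L. proper_flat r n G" for L
    using p L
  proof (induction p arbitrary: L rule: poly_carrier_induct)
    case (Const c)
    have "chain_monomial {F} * (\<Prod>G\<leftarrow>L. xvar G) \<in> S"
      using F Const
      by (intro chain_monomial_times_flats[OF rn S chain_monomial_in_subspace[OF rn S ret]])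
         (auto simp: flat_chain_def)
    then show ?case
      using mp.subspace_scale[OF S(1), of "chain_monomial {F} * (\<Prod>G\<leftarrow>L. xvar G)" c]
      by (simp add: chain_monomial_def mult.commute)
  next
    case (add p q)
    then show ?case using mp.subspace_add[OF S(1)] by (simp add: distrib_left)
  next
    case (Var v p)
    show ?case
    proof (cases v)
      case (RayF G)
      then have "xvar F * (\<Prod>G\<leftarrow>G # L. xvar G) * p \<in> S"
        using Var.hyps Var.prems by (intro Var.IH) (auto simp: RayF_in_rays)
      then show ?thesis unfolding RayF by (simp add: mult_ac)
    next
      case (RayE i)
      then have i: "i \<in> {1..n}" "1 \<le> r" using Var.hyps RayE_in_rays by blast+
      have "xvar F * (\<Prod>G\<leftarrow>L. xvar G) * (Var v * p)
          = (xvar F * (\<Prod>G\<leftarrow>L. xvar G) * p) * theta r n i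
            + (\<Sum>G\<in>{G. proper_flat r n G \<and> i \<notin> G}. xvar F * (\<Prod>G\<leftarrow>G # L. xvar G) * p)"
        unfolding theta_eq[OF i] RayE avoiding_sum_def
        by (simp add: algebra_simps sum_distrib_left)
      also have "\<dots> \<in> S"
      proof (rule mp.subspace_add[OF S(1)])
        have "(xvar F * (\<Prod>G\<leftarrow>L. xvar G) * p) * theta r n i \<in> chow_ideal r n"
          using Var.hyps Var.prems F(1) i(1)
          by (intro chow_ideal.mult chow_ideal.theta poly_carrier_mult xvar_carrier xvars_carrier) auto
        then show "(xvar F * (\<Prod>G\<leftarrow>L. xvar G) * p) * theta r n i \<in> S" using S(2) by blast
      qed (use Var.prems in \<open>intro mp.subspace_sum[OF S(1)] Var.IH, auto\<close>)
      finally show ?thesis .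
    qed
  qed
  from this[of "[]"] show ?thesis by simp
qed

lemma sorted_wrt_psubset_distinct: "sorted_wrt (\<subset>) fl \<Longrightarrow> distinct fl"
  by (induct fl) auto

lemma retral_monomial_eq:
  assumes "retral r n F fl"
  shows "xvar F * flag_monomial fl = chain_monomial (set fl)"
proof -
  have fl: "fl \<noteq> []" "hd fl = F" "sorted_wrt (\<subset>) fl"
    using assms unfolding retral_def contraction_flag_def by blast+
  then have "chain_monomial (set fl) = (\<Prod>G\<leftarrow>fl. xvar G)"
    unfolding chain_monomial_def by (simp add: prod.distinct_set_conv_list sorted_wrt_psubset_distinct)
  also have "\<dots> = xvar F * flag_monomial fl"
    using fl(1,2) unfolding flag_monomial_def by (cases fl) auto
  finally show ?thesis by simp
qed

lemma retral_proper:
  assumes "retral r n F fl" "G \<in> set fl"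
  shows "proper_flat r n G"
  using assms unfolding retral_def contraction_flag_def by blast

lemma retral_hd: "retral r n F fl \<Longrightarrow> fl \<noteq> [] \<and> hd fl = F"
  unfolding retral_def contraction_flag_def by blast

lemma retral_monomials_eq:
  "retral_monomials r n = insert 1 {chain_monomial (set fl) | fl. retral r n (hd fl) fl}"
proof -
  have "{xvar F * flag_monomial fl | F fl. proper_flat r n F \<and> retral r n F fl}
      = {chain_monomial (set fl) | fl. retral r n (hd fl) fl}"
  proof (intro equalityI subsetI)
    fix m assume "m \<in> {xvar F * flag_monomial fl | F fl. proper_flat r n F \<and> retral r n F fl}"
    then obtain F fl where "m = xvar F * flag_monomial fl" "retral r n F fl" by blast
    then show "m \<in> {chain_monomial (set fl) | fl. retral r n (hd fl) fl}"
      using retral_monomial_eq retral_hd by blast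
  next
    fix m assume "m \<in> {chain_monomial (set fl) | fl. retral r n (hd fl) fl}"
    then obtain fl where fl: "m = chain_monomial (set fl)" "retral r n (hd fl) fl" by blast
    then have "proper_flat r n (hd fl)" using retral_proper retral_hd hd_in_set by blast
    then show "m \<in> {xvar F * flag_monomial fl | F fl. proper_flat r n F \<and> retral r n F fl}"
      using fl retral_monomial_eq[OF fl(2)] by (intro CollectI exI[of _ "hd fl"] exI[of _ fl]) simp
  qed
  then show ?thesis unfolding retral_monomials_def by simp
qed

lemma poly_carrier_subset_span:
  assumes rn: "r \<le> n"
  shows "poly_carrier (rays r n) \<subseteq> mp.span (chow_ideal r n \<union> retral_monomials r n)"
proof
  fix p :: "ray mpoly" assume "p \<in> poly_carrier (rays r n)"
  define S where "S = mp.span (chow_ideal r n \<union> retral_monomials r n)"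
  have S: "mp.subspace S" "chow_ideal r n \<subseteq> S" and ret: "retral_monomials r n \<subseteq> S"
    unfolding S_def using mp.span_superset[of "chow_ideal r n \<union> retral_monomials r n"] by auto
  have one: "1 \<in> S" using ret unfolding retral_monomials_eq by blast
  have xS: "xvar F * p \<in> S" if "proper_flat r n F" "p \<in> poly_carrier (rays r n)" for F p
    using that ret unfolding retral_monomials_eq
    by (intro xvar_multiple_in_subspace[OF rn S, where t = 0]) blast+
  from \<open>p \<in> poly_carrier (rays r n)\<close> show "p \<in> S"
  proof (induction p rule: poly_carrier_induct)
    case (Const c)
    then show ?case using mp.subspace_scale[OF S(1) one, of c] by simp
  next
    case (add p q)
    then show ?case using mp.subspace_add[OF S(1)] by blast
  next
    case (Var v p)
    show ?case
    proof (cases v)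
      case (RayF G)
      then show ?thesis using Var.hyps xS RayF_in_rays by blast
    next
      case (RayE i)
      then have i: "i \<in> {1..n}" "1 \<le> r" using Var.hyps RayE_in_rays by blast+
      have "Var v * p = p * theta r n i + (\<Sum>G\<in>{G. proper_flat r n G \<and> i \<notin> G}. xvar G * p)"
        unfolding theta_eq[OF i] RayE avoiding_sum_def
        by (simp add: algebra_simps sum_distrib_left)
      also have "\<dots> \<in> S"
      proof (rule mp.subspace_add[OF S(1)])
        show "p * theta r n i \<in> S"
          using Var.hyps i(1) chow_ideal.mult chow_ideal.theta S(2) by blast
      qed (use Var.hyps xS in \<open>intro mp.subspace_sum[OF S(1)], auto\<close>)
      finally show ?thesis .
    qed
  qed
qed

section \<open>Retral flags and partial permutations\<close>

definition partial_perms :: "nat \<Rightarrow> nat list set" where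
  "partial_perms n = {xs. distinct xs \<and> set xs \<subseteq> {1..n}}"

lemma finite_partial_perms: "finite (partial_perms n)"
  using finite_subset_distinct[of "{1..n}"] by (simp add: partial_perms_def conj_commute)

text \<open>The maximum comes last and the rest is decreasing, so that in the word of a flag a block with
  at least two elements ends exactly where the first ascent after its beginning ends.\<close>

definition block_word :: "nat set \<Rightarrow> nat list" where
  "block_word S = rev (sorted_list_of_set (S - {Max S})) @ [Max S]"

fun flag_word :: "nat \<Rightarrow> nat set list \<Rightarrow> nat list" where
  "flag_word n [] = []"
| "flag_word n (F # fl) = block_word (hd (fl @ [{1..n}]) - F) @ flag_word n fl"

text \<open>Retrality as a recursion along the flag. The last block is the one ending at \<open>{1..n}\<close>; it is
  unconstrained, which is why \<open>fl \<noteq> []\<close> is required.\<close>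

fun retral_blocks :: "nat \<Rightarrow> nat set list \<Rightarrow> bool" where
  "retral_blocks n [] = True"
| "retral_blocks n (F # fl) = (F \<subset> hd (fl @ [{1..n}]) \<and> F \<subseteq> {1..n} \<and>
     (fl \<noteq> [] \<and> card (hd fl - F) = 1 \<longrightarrow> hd fl - F = {Max (hd (tl fl @ [{1..n}]) - F)}) \<and>
     retral_blocks n fl)"

lemma retral_imp_retral_blocks:
  assumes "retral n n F fl"
  shows "retral_blocks n fl"
proof -
  have "retral_blocks n fl"
    if "sorted_wrt (\<subset>) fl" "\<forall>G\<in>set fl. G \<subset> {1..n}"
      and "\<forall>k. 1 \<le> k \<and> k < length fl \<and> card ((fl @ [{1..n}]) ! k - (fl @ [{1..n}]) ! (k - 1)) = 1 \<longrightarrow>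
        (fl @ [{1..n}]) ! k - (fl @ [{1..n}]) ! (k - 1) =
          {Max ((fl @ [{1..n}]) ! (k + 1) - (fl @ [{1..n}]) ! (k - 1))}" for fl
    using that
  proof (induction fl)
    case (Cons F fl)
    have "retral_blocks n fl"
    proof (rule Cons.IH)
      show "\<forall>k. 1 \<le> k \<and> k < length fl \<and> card ((fl @ [{1..n}]) ! k - (fl @ [{1..n}]) ! (k - 1)) = 1 \<longrightarrow>
        (fl @ [{1..n}]) ! k - (fl @ [{1..n}]) ! (k - 1) =
          {Max ((fl @ [{1..n}]) ! (k + 1) - (fl @ [{1..n}]) ! (k - 1))}"
      proof (intro allI impI)
        fix k assume k: "1 \<le> k \<and> k < length fl \<and>
          card ((fl @ [{1..n}]) ! k - (fl @ [{1..n}]) ! (k - 1)) = 1"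
        then obtain k' where k': "k = Suc k'" by (cases k) auto
        show "(fl @ [{1..n}]) ! k - (fl @ [{1..n}]) ! (k - 1) =
          {Max ((fl @ [{1..n}]) ! (k + 1) - (fl @ [{1..n}]) ! (k - 1))}"
          using Cons.prems(3)[rule_format, of "Suc k"] k unfolding k' by simp
      qed
    qed (use Cons.prems in auto)
    moreover have "F \<subset> hd (fl @ [{1..n}])"
      using Cons.prems by (cases fl) auto
    moreover have "F \<subseteq> {1..n}" using Cons.prems by auto
    moreover have "fl \<noteq> [] \<and> card (hd fl - F) = 1 \<longrightarrow> hd fl - F = {Max (hd (tl fl @ [{1..n}]) - F)}"
    proof (cases fl)
      case (Cons G gl)
      then show ?thesis
        using Cons.prems(3)[rule_format, of 1] by (cases gl) auto
    qed simp
    ultimately show ?case by simp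
  qed simp
  moreover have "G \<subset> {1..n}" if "G \<in> set fl" for G
    using retral_proper[OF assms that] proper_flat_psubset by blast
  ultimately show ?thesis
    using assms unfolding retral_def contraction_flag_def Let_def by blast
qed

lemma block_word_props:
  assumes "finite S" "S \<noteq> {}"
  shows "set (block_word S) = S" "distinct (block_word S)" "length (block_word S) = card S"
    and "sorted_wrt (>) (butlast (block_word S))"
    and "\<And>a. a \<in> set (butlast (block_word S)) \<Longrightarrow> a < Max S \<and> a \<in> S"
proof -
  have M: "Max S \<in> S" using assms by simp
  show "set (block_word S) = S" "distinct (block_word S)"
    using assms(1) M by (auto simp: block_word_def intro: Max_in)
  then show "length (block_word S) = card S" using distinct_card[of "block_word S"] by simp
  have "sorted_wrt (<) (sorted_list_of_set (S - {Max S}))"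
    by (rule strict_sorted_list_of_set)
  then show "sorted_wrt (>) (butlast (block_word S))"
    by (simp add: block_word_def sorted_wrt_rev)
  fix a assume "a \<in> set (butlast (block_word S))"
  then have "a \<in> S - {Max S}" using assms by (simp add: block_word_def)
  then show "a < Max S \<and> a \<in> S" using assms by (simp add: order_less_le)
qed

lemma block_word_split: "block_word S = butlast (block_word S) @ [Max S]"
  by (simp add: block_word_def)

lemma first_block:
  assumes "retral_blocks n (F # fl)"
  shows "finite (hd (fl @ [{1..n}]) - F)" "hd (fl @ [{1..n}]) - F \<noteq> {}" "hd (fl @ [{1..n}]) \<subseteq> {1..n}"
proof -
  show N: "hd (fl @ [{1..n}]) \<subseteq> {1..n}"
    using assms by (cases fl) auto
  then show "finite (hd (fl @ [{1..n}]) - F)" using finite_subset by blast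
  show "hd (fl @ [{1..n}]) - F \<noteq> {}" using assms by auto
qed

lemma set_flag_word:
  "retral_blocks n fl \<Longrightarrow> fl \<noteq> [] \<Longrightarrow> set (flag_word n fl) = {1..n} - hd fl \<and> distinct (flag_word n fl)"
proof (induction fl)
  case (Cons F fl)
  let ?N = "hd (fl @ [{1..n}])"
  note S = first_block[OF Cons.prems(1)]
  have rest: "set (flag_word n fl) = {1..n} - ?N \<and> distinct (flag_word n fl)"
    using Cons by (cases fl) auto
  have "F \<subset> ?N" using Cons.prems(1) by simp
  then show ?case using rest block_word_props[OF S(1,2)] S(3) by auto
qed simp

text \<open>Up to the end of the first ascent, the word of a retral flag has no letter above the maximum
  of the first block: a block with at least two elements ends the first ascent with its maximum,
  and the element of a singleton block exceeds the whole next block by retrality.\<close>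

lemma letter_after_descents_le:
  assumes "retral_blocks n (F # fl)" "flag_word n (F # fl) = d @ m # u" "sorted_wrt (>) d"
  shows "m \<le> Max (hd (fl @ [{1..n}]) - F)"
  using assms
proof (induction fl arbitrary: F d)
  case Nil
  note S = first_block[OF Nil.prems(1)]
  have "m \<in> set (flag_word n [F])" using Nil.prems(2) by (metis in_set_conv_decomp)
  then show ?case using set_flag_word[OF Nil.prems(1)] by simp
next
  case (Cons N fl)
  define S M where "S = N - F" and "M = hd (fl @ [{1..n}])"
  note block = first_block[OF Cons.prems(1)]
  have S: "finite S" "S \<noteq> {}" using block unfolding S_def by auto
  have word: "block_word S @ flag_word n (N # fl) = d @ m # u"
    using Cons.prems(2) by (simp add: S_def)
  have "m \<le> Max S"
  proof (cases "length d < length (block_word S)")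
    case True
    then have "(block_word S @ flag_word n (N # fl)) ! length d \<in> set (block_word S)"
      by (simp add: nth_append)
    then show ?thesis using S block_word_props(1) word by simp
  next
    case False
    have "\<exists>d'. d = B @ d' \<and> w = d' @ m # u" if "B @ w = d @ m # u" "\<not> length d < length B" for B w
      using that by (auto simp: append_eq_append_conv2)
    then obtain d' where d': "d = block_word S @ d'" "flag_word n (N # fl) = d' @ m # u"
      using word False by blast
    have "sorted_wrt (>) (butlast (block_word S) @ [Max S])"
      using Cons.prems(3) d'(1) block_word_split[of S] by (simp add: sorted_wrt_append)
    then have "\<forall>a\<in>set (butlast (block_word S)). Max S < a" by (simp add: sorted_wrt_append)
    then have "set (butlast (block_word S)) = {}"
      using block_word_props(5)[OF S] by (meson equals0I less_asym)
    then have "butlast (block_word S) = []" by simp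
    then have "block_word S = [Max S]" using block_word_split[of S] by (metis append_Nil)
    then have "card S = 1" using block_word_props(3)[OF S] by simp
    then have SM: "S = {Max (M - F)}" using Cons.prems(1) unfolding S_def M_def by simp
    have "retral_blocks n (N # fl)" using Cons.prems(1) by simp
    then have "m \<le> Max (M - N)"
      using Cons.IH[OF _ d'(2)] Cons.prems(3) unfolding M_def d'(1) by (simp add: sorted_wrt_append)
    also have "\<dots> \<le> Max (M - F)"
      using first_block[OF \<open>retral_blocks n (N # fl)\<close>] Cons.prems(1) unfolding M_def
      by (intro Max_mono) (auto intro: finite_subset)
    finally show ?thesis using SM by simp
  qed
  then show ?case by (simp add: S_def)
qed

text \<open>If one flag had a longer first block than another with the same word, then the shorter first
  block would lie in the decreasing part of the longer one, below the maximum that ends it.\<close>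

lemma first_block_not_shorter:
  assumes "retral_blocks n (F # fl)" "retral_blocks n (F # fl')"
    and eq: "flag_word n (F # fl) = flag_word n (F # fl')"
  shows "card (hd (fl' @ [{1..n}]) - F) \<le> card (hd (fl @ [{1..n}]) - F)"
proof (rule ccontr)
  define S S' where "S = hd (fl @ [{1..n}]) - F" and "S' = hd (fl' @ [{1..n}]) - F"
  assume "\<not> ?thesis"
  then have less: "card S < card S'" unfolding S_def S'_def by simp
  have S: "finite S" "S \<noteq> {}" "finite S'" "S' \<noteq> {}"
    using first_block[OF assms(1)] first_block[OF assms(2)] unfolding S_def S'_def by auto
  have word: "block_word S @ flag_word n fl = butlast (block_word S') @ Max S' # flag_word n fl'"
    using eq block_word_split[of S'] unfolding S_def S'_def by simp
  then have "Max S' \<le> Max S"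
    using letter_after_descents_le[OF assms(1), of "butlast (block_word S')"] block_word_props(4)[OF S(3,4)]
    unfolding S_def by simp
  have "length (block_word S) \<le> length (butlast (block_word S'))"
    using less block_word_props(3) S by simp
  then have "set (block_word S) \<subseteq> set (butlast (block_word S'))"
    using word by (metis append_eq_append_conv_if set_take_subset)
  then have "Max S \<in> set (butlast (block_word S'))"
    using block_word_props(1)[OF S(1,2)] Max_in[OF S(1,2)] by blast
  then have "Max S < Max S'" using block_word_props(5)[OF S(3,4)] by blast
  with \<open>Max S' \<le> Max S\<close> show False by simp
qed

lemma flag_word_inj:
  "retral_blocks n fl \<Longrightarrow> retral_blocks n fl' \<Longrightarrow> flag_word n fl = flag_word n fl' \<Longrightarrow> fl = fl'"
proof (induction fl arbitrary: fl')
  case Nil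
  then show ?case by (cases fl') (auto simp: block_word_def)
next
  case (Cons F fl)
  then obtain F' gl where fl': "fl' = F' # gl" by (cases fl') (auto simp: block_word_def)
  have "{1..n} - F = {1..n} - F'"
    using set_flag_word[OF Cons.prems(1)] set_flag_word[OF Cons.prems(2)] Cons.prems(3) fl'
    by (simp del: flag_word.simps)
  moreover have "F \<subseteq> {1..n}" "F' \<subseteq> {1..n}" using Cons.prems(1,2) fl' by simp_all
  ultimately have F: "F' = F" by blast
  define N N' where "N = hd (fl @ [{1..n}])" and "N' = hd (gl @ [{1..n}])"
  have r: "retral_blocks n (F # fl)" "retral_blocks n (F # gl)"
    using Cons.prems fl' F by auto
  have eq: "flag_word n (F # fl) = flag_word n (F # gl)" using Cons.prems fl' F by simp
  have "card (N - F) = card (N' - F)"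
    using first_block_not_shorter[OF r eq] first_block_not_shorter[OF r(2,1) eq[symmetric]]
    unfolding N_def N'_def by simp
  then have "length (block_word (N - F)) = length (block_word (N' - F))"
    using first_block[OF r(1)] first_block[OF r(2)] block_word_props(3) unfolding N_def N'_def by simp
  then have "flag_word n fl = flag_word n gl"
    using eq unfolding N_def N'_def by simp
  then show ?case using Cons.IH[of gl] r fl' F by simp
qed

text \<open>The word of a flag starting at \<open>F\<close> is an ordering of the complement of \<open>F\<close>, and the monomial
  \<open>1\<close> corresponds to the empty word.\<close>

lemma card_retral_monomials_le:
  "finite (retral_monomials n n)" "card (retral_monomials n n) \<le> card (partial_perms n)"
proof -
  define A where "A = insert [] {fl. retral n n (hd fl) fl}"
  have blocks: "retral_blocks n fl" if "fl \<in> A" for fl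
    using that retral_imp_retral_blocks unfolding A_def by auto
  have inj: "inj_on (flag_word n) A"
    using blocks flag_word_inj by (intro inj_onI) blast
  have sub: "flag_word n ` A \<subseteq> partial_perms n"
  proof
    fix w assume "w \<in> flag_word n ` A"
    then obtain fl where fl: "fl \<in> A" "w = flag_word n fl" by blast
    show "w \<in> partial_perms n"
      using set_flag_word[OF blocks[OF fl(1)]] fl(2)
      by (cases "fl = []") (auto simp: partial_perms_def)
  qed
  have finA: "finite A" using inj sub finite_partial_perms by (metis finite_imageD finite_subset)
  have R: "retral_monomials n n \<subseteq> (\<lambda>fl. chain_monomial (set fl)) ` A"
    unfolding retral_monomials_eq A_def by (auto simp: chain_monomial_def)
  show "finite (retral_monomials n n)" using R finA finite_surj by blast
  have "card (retral_monomials n n) \<le> card A" using R finA by (rule surj_card_le[rotated])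
  also have "\<dots> \<le> card (partial_perms n)"
    using card_inj_on_le[OF inj sub finite_partial_perms] .
  finally show "card (retral_monomials n n) \<le> card (partial_perms n)" .
qed

section \<open>Linear forms on polynomials\<close>

definition linear_extension :: "(('v \<Rightarrow>\<^sub>0 nat) \<Rightarrow> rat) \<Rightarrow> 'v mpoly \<Rightarrow> rat" where
  "linear_extension f p = (\<Sum>m\<in>Poly_Mapping.keys p. Poly_Mapping.lookup p m * f m)"

lemma linear_extension_0 [simp]: "linear_extension f 0 = 0"
  by (simp add: linear_extension_def)

lemma linear_extension_add: "linear_extension f (p + q) = linear_extension f p + linear_extension f q"
  unfolding linear_extension_def
  by (rule setsum_keys_plus_distrib) (simp_all add: distrib_right)

lemma linear_extension_sum: "linear_extension f (sum g A) = (\<Sum>a\<in>A. linear_extension f (g a))"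
  by (induct A rule: infinite_finite_induct) (simp_all add: linear_extension_add)

lemma linear_extension_single [simp]: "linear_extension f (Poly_Mapping.single m c) = c * f m"
  by (simp add: linear_extension_def)

lemma linear_extension_Const_mult: "linear_extension f (Const c * p) = c * linear_extension f p"
proof -
  have "linear_extension f (Const c * p) = linear_extension f
      (\<Sum>m\<in>Poly_Mapping.keys p. Poly_Mapping.single m (c * Poly_Mapping.lookup p m))"
    by (subst mpoly_eq_sum_single) (simp add: sum_distrib_left Const_mult_single)
  then show ?thesis
    by (simp add: linear_extension_sum linear_extension_def[of f p] sum_distrib_left mult.assoc)
qed

lemma linear_extension_Var_mult:
  "linear_extension f (Var v * p) = linear_extension (\<lambda>m. f (m + Poly_Mapping.single v 1)) p"
proof -
  have "linear_extension f (Var v * p) = linear_extension f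
      (\<Sum>m\<in>Poly_Mapping.keys p. Poly_Mapping.single (m + Poly_Mapping.single v 1) (Poly_Mapping.lookup p m))"
    by (subst mpoly_eq_sum_single) (simp add: sum_distrib_left Var_mult_single)
  then show ?thesis
    by (simp add: linear_extension_sum linear_extension_def[of _ p])
qed

definition mono_degree :: "('v \<Rightarrow>\<^sub>0 nat) \<Rightarrow> nat" where
  "mono_degree m = (\<Sum>v\<in>Poly_Mapping.keys m. Poly_Mapping.lookup m v)"

definition mono_value :: "('v \<Rightarrow> rat) \<Rightarrow> ('v \<Rightarrow>\<^sub>0 nat) \<Rightarrow> rat" where
  "mono_value \<phi> m = (\<Prod>v\<in>Poly_Mapping.keys m. \<phi> v ^ Poly_Mapping.lookup m v)"

lemma lookup_add_single:
  "Poly_Mapping.lookup (m + Poly_Mapping.single v (1::nat)) =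
     (Poly_Mapping.lookup m)(v := Suc (Poly_Mapping.lookup m v))"
  by (auto simp: lookup_add lookup_single when_def fun_eq_iff)

lemma keys_add_single: "Poly_Mapping.keys (m + Poly_Mapping.single v (1::nat)) = insert v (Poly_Mapping.keys m)"
  by (auto simp: in_keys_iff lookup_add lookup_single when_def split: if_splits)

lemma mono_degree_add_single: "mono_degree (m + Poly_Mapping.single v 1) = Suc (mono_degree m)"
proof -
  have "mono_degree m = (\<Sum>w\<in>insert v (Poly_Mapping.keys m). Poly_Mapping.lookup m w)"
    unfolding mono_degree_def by (rule sum.mono_neutral_left) (auto simp: in_keys_iff)
  then show ?thesis
    unfolding mono_degree_def keys_add_single lookup_add_single
    by (simp add: sum.insert_remove)
qed

lemma mono_value_add_single: "mono_value \<phi> (m + Poly_Mapping.single v 1) = \<phi> v * mono_value \<phi> m"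
proof -
  have "mono_value \<phi> m = (\<Prod>w\<in>insert v (Poly_Mapping.keys m). \<phi> w ^ Poly_Mapping.lookup m w)"
    unfolding mono_value_def by (rule prod.mono_neutral_left) (auto simp: in_keys_iff)
  then show ?thesis
    unfolding mono_value_def keys_add_single lookup_add_single
    by (simp add: prod.insert_remove mult.assoc)
qed

section \<open>Evaluation at partial permutations\<close>

text \<open>At the point \<open>x\<^sub>1, \<dots>, x\<^sub>k\<close> the variable of the flat with complement \<open>{x\<^sub>j, \<dots>, x\<^sub>k}\<close> takes the
  value \<open>x\<^sub>j - x\<^bsub>j-1\<^esub>\<close>, where \<open>x\<^sub>0\<close> is the parameter \<open>a\<close>, and all other variables of flats vanish. So
  the variables of the flats avoiding \<open>i = x\<^sub>j\<close> add up to the telescoping sum \<open>i - a\<close>.\<close>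

fun chain_value :: "rat \<Rightarrow> nat list \<Rightarrow> nat set \<Rightarrow> rat" where
  "chain_value a [] C = 0"
| "chain_value a (x # xs) C = (if C = set (x # xs) then of_nat x - a else 0) + chain_value (of_nat x) xs C"

fun ray_value :: "nat \<Rightarrow> nat list \<Rightarrow> ray \<Rightarrow> rat" where
  "ray_value n xs (RayE i) = (if i \<in> set xs then 0 else - of_nat i)"
| "ray_value n xs (RayF F) = chain_value 0 xs ({1..n} - F)"

lemma chain_value_subset: "chain_value a xs C \<noteq> 0 \<Longrightarrow> C \<subseteq> set xs \<and> C \<noteq> {}"
proof (induct xs arbitrary: a)
  case (Cons x xs)
  then show ?case by (cases "C = set (x # xs)") auto
qed simp

lemma chain_value_comparable:
  "chain_value a xs C \<noteq> 0 \<Longrightarrow> chain_value b xs D \<noteq> 0 \<Longrightarrow> C \<subseteq> D \<or> D \<subseteq> C"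
proof (induct xs arbitrary: a b)
  case (Cons x xs)
  show ?case
  proof (cases "C = set (x # xs) \<or> D = set (x # xs)")
    case True
    then show ?thesis using chain_value_subset[OF Cons.prems(1)] chain_value_subset[OF Cons.prems(2)] by auto
  next
    case False
    then have "chain_value (of_nat x) xs C \<noteq> 0" "chain_value (of_nat x) xs D \<noteq> 0"
      using Cons.prems by auto
    then show ?thesis by (rule Cons.hyps)
  qed
qed simp

lemma chain_value_top: "distinct (x # xs) \<Longrightarrow> chain_value a (x # xs) (set (x # xs)) = of_nat x - a"
  using chain_value_subset[of "of_nat x" xs "set (x # xs)"] by auto

lemma sum_chain_value:
  assumes "finite U" "distinct xs" "set xs \<subseteq> U"
  shows "(\<Sum>C\<in>{C. C \<subseteq> U \<and> i \<in> C}. chain_value a xs C) = (if i \<in> set xs then of_nat i - a else 0)"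
  using assms(2,3)
proof (induct xs arbitrary: a)
  case (Cons x xs)
  have fin: "finite {C. C \<subseteq> U \<and> i \<in> C}" using assms(1) by (simp add: finite_subset[of _ "Pow U"] subset_iff)
  have "(\<Sum>C\<in>{C. C \<subseteq> U \<and> i \<in> C}. if C = set (x # xs) then of_nat x - a else 0)
      = (if i \<in> set (x # xs) then of_nat x - a else 0)"
    using fin Cons.prems by (subst sum.delta) auto
  moreover have "(\<Sum>C\<in>{C. C \<subseteq> U \<and> i \<in> C}. chain_value (of_nat x) xs C)
      = (if i \<in> set xs then of_nat i - of_nat x else 0)"
    using Cons by simp
  moreover have "x \<notin> set xs" using Cons.prems by simp
  ultimately show ?case by (auto simp: sum.distrib)
qed simp

lemma chain_value_inj:
  assumes "distinct xs" "distinct ys" "a \<notin> of_nat ` set xs" "a \<notin> of_nat ` set ys"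
    and "\<And>C. chain_value a xs C = chain_value a ys C"
  shows "xs = ys"
  using assms
proof (induct xs arbitrary: ys a)
  case Nil
  show ?case
  proof (cases ys)
    case (Cons y ys')
    then have "chain_value a ys (set ys) = of_nat y - a"
      using chain_value_top Nil.prems(2) by blast
    then show ?thesis using Nil.prems(4) Nil.prems(5)[of "set ys"] Cons by simp
  qed simp
next
  case (Cons x xs)
  have X: "chain_value a (x # xs) (set (x # xs)) = of_nat x - a" "of_nat x \<noteq> a"
    using chain_value_top Cons.prems by (blast, auto)
  then have "set (x # xs) \<subseteq> set ys"
    using Cons.prems(5)[of "set (x # xs)"] chain_value_subset[of a ys "set (x # xs)"] by simp
  then obtain y ys' where ys: "ys = y # ys'" by (cases ys) auto
  have Y: "chain_value a ys (set ys) = of_nat y - a" "of_nat y \<noteq> a"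
    using chain_value_top Cons.prems ys by (blast, auto)
  then have "set ys \<subseteq> set (x # xs)"
    using Cons.prems(5)[of "set ys"] chain_value_subset[of a "x # xs" "set ys"] by simp
  with \<open>set (x # xs) \<subseteq> set ys\<close> have sets: "set (x # xs) = set ys" by blast
  then have "(of_nat x :: rat) = of_nat y" using X Y Cons.prems(5)[of "set ys"] by simp
  then have xy: "x = y" by simp
  have "chain_value (of_nat x) xs C = chain_value (of_nat x) ys' C" for C
    using Cons.prems(5)[of C] sets unfolding ys xy by (simp split: if_splits)
  then have "xs = ys'"
    using Cons.prems(1,2) ys xy by (intro Cons.hyps[of ys' "of_nat x"]) auto
  then show ?case using ys xy by simp
qed

lemma ray_value_flats_comparable:
  assumes "F \<subseteq> {1..n}" "G \<subseteq> {1..n}" "\<not> F \<subseteq> G" "\<not> G \<subseteq> F"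
  shows "ray_value n xs (RayF F) * ray_value n xs (RayF G) = 0"
  using chain_value_comparable[of 0 xs "{1..n} - F" 0 "{1..n} - G"] assms by auto

lemma ray_value_element_flat:
  assumes "i \<in> {1..n}" "i \<notin> F"
  shows "ray_value n xs (RayE i) * ray_value n xs (RayF F) = 0"
proof (cases "chain_value 0 xs ({1..n} - F) = 0")
  case False
  then have "{1..n} - F \<subseteq> set xs" using chain_value_subset by blast
  then show ?thesis using assms by auto
qed simp

text \<open>At a partial permutation the linear form \<open>\<theta>\<^sub>i\<close> takes the constant value \<open>-i\<close>: the points are
  the solutions of the deformation of the linear relations with these constants.\<close>

lemma ray_value_theta:
  assumes xs: "xs \<in> partial_perms n" and i: "i \<in> {1..n}"
  shows "ray_value n xs (RayE i) - (\<Sum>F\<in>{F. proper_flat n n F \<and> i \<notin> F}. ray_value n xs (RayF F)) = - of_nat i"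
proof -
  have "(\<Sum>F\<in>{F. proper_flat n n F \<and> i \<notin> F}. ray_value n xs (RayF F))
      = (\<Sum>C\<in>{C. C \<subseteq> {1..n} \<and> i \<in> C}. chain_value 0 xs C)"
  proof (rule sum.reindex_bij_witness[of _ "\<lambda>C. {1..n} - C" "\<lambda>F. {1..n} - F"])
    fix C assume C: "C \<in> {C. C \<subseteq> {1..n} \<and> i \<in> C}"
    then have "card ({1..n} - C) < card {1..n}" by (intro psubset_card_mono) auto
    then show "{1..n} - C \<in> {F. proper_flat n n F \<and> i \<notin> F}" using C by (simp add: proper_flat_def)
  qed (use i proper_flat_subset in \<open>auto simp: double_diff\<close>)
  also have "\<dots> = (if i \<in> set xs then of_nat i else 0)"
    using sum_chain_value[of "{1..n}" xs 0 i] xs by (simp add: partial_perms_def)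
  finally show ?thesis by simp
qed

lemma ray_value_separates:
  assumes "xs \<in> partial_perms n" "ys \<in> partial_perms n" "xs \<noteq> ys"
  obtains v where "v \<in> rays n n" "ray_value n xs v \<noteq> ray_value n ys v"
proof -
  have "(0::rat) \<notin> of_nat ` set zs" if "zs \<in> partial_perms n" for zs
    using that by (auto simp: partial_perms_def)
  then obtain C where C: "chain_value 0 xs C \<noteq> chain_value 0 ys C"
    using chain_value_inj[of xs ys 0] assms unfolding partial_perms_def by blast
  then have C1: "C \<subseteq> {1..n}" "C \<noteq> {}"
    using chain_value_subset[of 0 xs C] chain_value_subset[of 0 ys C] assms
    unfolding partial_perms_def by fastforce+
  then have "card ({1..n} - C) < card {1..n}" by (intro psubset_card_mono) auto
  then have "RayF ({1..n} - C) \<in> rays n n" by (simp add: RayF_in_rays proper_flat_def)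
  moreover have "ray_value n xs (RayF ({1..n} - C)) \<noteq> ray_value n ys (RayF ({1..n} - C))"
    using C C1(1) by (simp add: double_diff)
  ultimately show thesis by (rule that)
qed

section \<open>Linear independence in top rank\<close>

interpretation fs: vector_space "\<lambda>(c::rat) (f::nat list \<Rightarrow> rat) xs. c * f xs"
  by unfold_locales (simp_all add: fun_eq_iff algebra_simps)

text \<open>The evaluation of the part of degree \<open>d\<close> at the points. It vanishes outside the points, so that
  the functions in question form a space of finite dimension.\<close>

definition component :: "nat \<Rightarrow> nat \<Rightarrow> ray mpoly \<Rightarrow> nat list \<Rightarrow> rat" where
  "component n d p = (\<lambda>xs. if xs \<in> partial_perms n then
     linear_extension (\<lambda>m. if mono_degree m = d then mono_value (ray_value n xs) m else 0) p else 0)"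

lemma component_0 [simp]: "component n d 0 = 0"
  by (simp add: component_def fun_eq_iff)

lemma component_add: "component n d (p + q) = component n d p + component n d q"
  by (simp add: component_def fun_eq_iff linear_extension_add)

lemma component_Const_mult: "component n d (Const c * p) = (\<lambda>xs. c * component n d p xs)"
  by (simp add: component_def fun_eq_iff linear_extension_Const_mult)

lemma component_uminus: "component n d (- p) = - component n d p"
  using component_Const_mult[of n d "-1" p] by (simp add: Const_minus fun_eq_iff)

lemma component_diff: "component n d (p - q) = component n d p - component n d q"
  using component_add[of n d p "- q"] by (simp add: component_uminus)

lemma component_sum: "component n d (sum g A) = (\<Sum>a\<in>A. component n d (g a))"
  by (induct A rule: infinite_finite_induct) (simp_all add: component_add)

lemma component_Const:
  "component n d (Const c) = (\<lambda>xs. if xs \<in> partial_perms n \<and> d = 0 then c else 0)"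
  by (simp add: component_def fun_eq_iff Const_def mono_degree_def mono_value_def)

lemma component_Var_mult_0: "component n 0 (Var v * p) = 0"
  unfolding component_def linear_extension_Var_mult mono_degree_add_single
  by (simp add: fun_eq_iff linear_extension_def)

lemma component_Var_mult_Suc:
  "component n (Suc d) (Var v * p) = (\<lambda>xs. ray_value n xs v * component n d p xs)"
proof
  fix xs
  have "linear_extension (\<lambda>m. if Suc (mono_degree m) = Suc d
        then ray_value n xs v * mono_value (ray_value n xs) m else 0) p
      = ray_value n xs v * linear_extension (\<lambda>m. if mono_degree m = d
        then mono_value (ray_value n xs) m else 0) p"
    unfolding linear_extension_def sum_distrib_left by (intro sum.cong) auto
  then show "component n (Suc d) (Var v * p) xs = ray_value n xs v * component n d p xs"
    unfolding component_def linear_extension_Var_mult mono_degree_add_single mono_value_add_single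
    by simp
qed

lemma sum_fun_apply: "(\<Sum>a\<in>A. g a) x = (\<Sum>a\<in>A. (g a x :: rat))"
  by (induct A rule: infinite_finite_induct) simp_all

lemma component_Var:
  "component n d (Var v) = (\<lambda>xs. if xs \<in> partial_perms n \<and> d = 1 then ray_value n xs v else 0)"
proof (cases d)
  case 0
  then show ?thesis using component_Var_mult_0[of n v 1] by (simp add: fun_eq_iff)
next
  case (Suc e)
  then show ?thesis
    using component_Var_mult_Suc[of n e v 1] component_Const[of n e 1] by (auto simp: fun_eq_iff)
qed

definition lower_values :: "nat \<Rightarrow> nat \<Rightarrow> (nat list \<Rightarrow> rat) set" where
  "lower_values n d = fs.span {component n e p | e p. e < d \<and> p \<in> poly_carrier (rays n n)}"

lemma component_in_lower_values:
  "e < d \<Longrightarrow> p \<in> poly_carrier (rays n n) \<Longrightarrow> component n e p \<in> lower_values n d"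
  unfolding lower_values_def by (rule fs.span_base) blast

lemma subspace_lower_values: "fs.subspace (lower_values n d)"
  by (simp add: lower_values_def)

lemma subspace_pointwise_mult:
  assumes V: "fs.subspace V"
  shows "fs.subspace {g. (\<lambda>xs. w xs * g xs) \<in> V}"
proof -
  have "(\<lambda>xs. w xs * (f + g) xs) = (\<lambda>xs. w xs * f xs) + (\<lambda>xs. w xs * g xs)" for f g
    by (simp add: fun_eq_iff distrib_left)
  moreover have "(\<lambda>xs. w xs * (c * g xs)) = (\<lambda>xs. c * (w xs * g xs))" for c g
    by (simp add: fun_eq_iff)
  moreover have "(\<lambda>xs. w xs * (0 :: nat list \<Rightarrow> rat) xs) = 0" by (simp add: fun_eq_iff)
  ultimately show ?thesis
    using fs.subspace_0[OF V] fs.subspace_add[OF V] fs.subspace_scale[OF V]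
    by (intro fs.subspaceI) simp_all
qed

lemma lower_values_mult:
  assumes g: "g \<in> lower_values n d" and v: "v \<in> rays n n"
  shows "(\<lambda>xs. ray_value n xs v * g xs) \<in> lower_values n (Suc d)"
  using g unfolding lower_values_def[of n d]
proof (induction g rule: fs.span_induct)
  case base
  show ?case by (rule subspace_pointwise_mult[OF subspace_lower_values])
next
  case (step g)
  then obtain e p where g: "g = component n e p" "e < d" "p \<in> poly_carrier (rays n n)" by blast
  then have "component n (Suc e) (Var v * p) \<in> lower_values n (Suc d)"
    using v by (intro component_in_lower_values poly_carrier_mult poly_carrier_Var) auto
  then show ?case unfolding g(1) component_Var_mult_Suc .
qed

lemma component_nonface:
  assumes S: "S \<subseteq> rays n n" and nf: "\<not> face n n S"
  shows "component n d (\<Prod>\<rho>\<in>S. Var \<rho>) = 0"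
proof -
  have pair: "component n d (\<Prod>\<rho>\<in>S. Var \<rho>) = 0"
    if \<rho>: "\<rho> \<in> S" "\<sigma> \<in> S" "\<rho> \<noteq> \<sigma>" and zero: "\<And>xs. ray_value n xs \<rho> * ray_value n xs \<sigma> = 0" for \<rho> \<sigma>
  proof -
    have fin: "finite S" using S finite_rays finite_subset by blast
    define q :: "ray mpoly" where "q = (\<Prod>\<tau>\<in>S - {\<rho>} - {\<sigma>}. Var \<tau>)"
    have "(\<Prod>\<tau>\<in>S. Var \<tau>) = Var \<rho> * (Var \<sigma> * q)"
      using prod.remove[OF fin \<rho>(1), of Var] prod.remove[of "S - {\<rho>}" \<sigma> Var] fin \<rho>
      unfolding q_def by simp
    then show ?thesis
    proof (cases d)
      case (Suc e)
      then show ?thesis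
      proof (cases e)
        case (Suc f)
        then show ?thesis
          using zero \<open>d = Suc e\<close> \<open>(\<Prod>\<tau>\<in>S. Var \<tau>) = Var \<rho> * (Var \<sigma> * q)\<close>
          by (auto simp: component_Var_mult_Suc fun_eq_iff)
      qed (simp add: component_Var_mult_Suc component_Var_mult_0 \<open>d = Suc e\<close>
            \<open>(\<Prod>\<tau>\<in>S. Var \<tau>) = Var \<rho> * (Var \<sigma> * q)\<close> fun_eq_iff)
    qed (simp add: component_Var_mult_0)
  qed
  from S nf show ?thesis
  proof (cases rule: nonface_obtains_bad_pair)
    case (1 F G)
    then have "F \<subseteq> {1..n}" "G \<subseteq> {1..n}" using S RayF_in_rays proper_flat_subset by blast+
    then have "ray_value n xs (RayF F) * ray_value n xs (RayF G) = 0" for xs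
      using 1 ray_value_flats_comparable by blast
    then show ?thesis using 1 by (intro pair[of "RayF F" "RayF G"]) auto
  next
    case (2 i F)
    then have "i \<in> {1..n}" using S RayE_in_rays by blast
    then have "ray_value n xs (RayE i) * ray_value n xs (RayF F) = 0" for xs
      using 2 ray_value_element_flat by blast
    then show ?thesis using 2 by (intro pair[of "RayE i" "RayF F"]) auto
  qed
qed

lemma component_theta:
  assumes i: "i \<in> {1..n}"
  shows "component n d (theta n n i) \<in> lower_values n d"
proof -
  have th: "theta n n i = yvar i - (\<Sum>F\<in>{F. proper_flat n n F \<and> i \<notin> F}. xvar F)"
    using theta_eq[of i n n] i by (simp add: avoiding_sum_def)
  show ?thesis
  proof (cases "d = 1")
    case True
    have "component n d (theta n n i) xs = component n 0 (Const (- of_nat i)) xs" for xs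
    proof (cases "xs \<in> partial_perms n")
      case xs: True
      have "component n d (theta n n i) xs = ray_value n xs (RayE i)
          - (\<Sum>F\<in>{F. proper_flat n n F \<and> i \<notin> F}. ray_value n xs (RayF F))"
        unfolding th component_diff component_sum component_Var using True xs by (simp add: sum_fun_apply)
      also have "\<dots> = - of_nat i" using ray_value_theta[OF xs i] .
      finally show ?thesis using xs by (simp add: component_Const)
    qed (simp add: component_def)
    then have "component n d (theta n n i) = component n 0 (Const (- of_nat i))" by (rule ext)
    then show ?thesis using True component_in_lower_values[OF _ poly_carrier_Const] by simp
  next
    case False
    then have "component n d (theta n n i) = 0"
      unfolding th component_diff component_sum component_Var by (simp add: fun_eq_iff sum_fun_apply)
    then show ?thesis using fs.subspace_0[OF subspace_lower_values] by simp
  qed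
qed

text \<open>The monomial relations hold at the points, and the linear forms are constant there instead of
  zero. So a homogeneous relation of degree \<open>d\<close> in the Chow ring holds for functions on the points
  up to degrees below \<open>d\<close>. Speaking of all components of a polynomial makes this stable under
  multiplication with polynomials that are not homogeneous.\<close>

lemma component_chow_ideal:
  "p \<in> chow_ideal n n \<Longrightarrow> component n d p \<in> lower_values n d"
proof (induction p arbitrary: d rule: chow_ideal.induct)
  case zero
  show ?case unfolding component_0 by (rule fs.subspace_0[OF subspace_lower_values])
next
  case (nonface S)
  then have "\<not> face n n S" using face_imp_cone by blast
  then show ?case
    unfolding component_nonface[OF nonface.hyps(1) \<open>\<not> face n n S\<close>]
    by (intro fs.subspace_0[OF subspace_lower_values])
next
  case (theta i)
  then show ?case by (rule component_theta)
next
  case (add p q)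
  then show ?case unfolding component_add by (intro fs.subspace_add[OF subspace_lower_values])
next
  case (mult p q)
  have "\<forall>d. component n d (p * q) \<in> lower_values n d"
    using mult.hyps(1)
  proof (induction p rule: poly_carrier_induct)
    case (Const c)
    show ?case
      using fs.subspace_scale[OF subspace_lower_values mult.IH] by (simp add: component_Const_mult)
  next
    case (add p1 p2)
    then show ?case
      unfolding distrib_right component_add by (blast intro: fs.subspace_add[OF subspace_lower_values])
  next
    case (Var v p')
    show ?case
    proof
      fix d
      show "component n d (Var v * p' * q) \<in> lower_values n d"
      proof (cases d)
        case 0
        then show ?thesis
          unfolding 0 mult.assoc component_Var_mult_0
          by (intro fs.subspace_0[OF subspace_lower_values])
      next
        case (Suc e)
        then show ?thesis
          using lower_values_mult[OF _ Var.hyps(1)] Var.IH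
          by (simp add: mult.assoc component_Var_mult_Suc)
      qed
    qed
  qed
  then show ?case by blast
qed

lemma component_chain_monomial:
  "finite C \<Longrightarrow> d \<noteq> card C \<Longrightarrow> component n d (chain_monomial C) = 0"
proof (induction C arbitrary: d rule: finite_induct)
  case empty
  then show ?case using component_Const[of n d 1] by (simp add: chain_monomial_def fun_eq_iff)
next
  case (insert F C)
  then show ?case
    by (cases d) (auto simp: chain_monomial_insert component_Var_mult_0 component_Var_mult_Suc fun_eq_iff)
qed

lemma retral_monomial_homogeneous:
  assumes "b \<in> retral_monomials n n"
  shows "\<exists>e. \<forall>d. d \<noteq> e \<longrightarrow> component n d b = 0"
proof -
  have "\<exists>C. finite C \<and> b = chain_monomial C"
    using assms unfolding retral_monomials_eq
    by (auto simp: chain_monomial_def intro: exI[of _ "{}"] exI[of _ "set _"])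
  then show ?thesis using component_chain_monomial by blast
qed

text \<open>Interpolation: multiply differences of a variable and a constant, one for each other point,
  where the variable separates that point from \<open>xs\<close>.\<close>

lemma indicator_in_values:
  assumes xs: "xs \<in> partial_perms n"
  shows "(\<lambda>ys. if ys = xs then 1 else 0) \<in> fs.span {component n e p | e p. p \<in> poly_carrier (rays n n)}"
    (is "_ \<in> ?U")
proof -
  have U_mult: "(\<lambda>ys. ray_value n ys v * g ys) \<in> ?U" if g: "g \<in> ?U" and v: "v \<in> rays n n" for g v
    using g
  proof (induction g rule: fs.span_induct)
    case base
    show ?case by (rule subspace_pointwise_mult[OF fs.subspace_span])
  next
    case (step g)
    then obtain e p where g: "g = component n e p" "p \<in> poly_carrier (rays n n)" by blast
    then have "Var v * p \<in> poly_carrier (rays n n)"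
      using v by (intro poly_carrier_mult poly_carrier_Var)
    then have "component n (Suc e) (Var v * p) \<in> ?U" by (intro fs.span_base) blast
    then show ?case unfolding g(1) component_Var_mult_Suc .
  qed
  have "\<exists>g\<in>?U. g xs \<noteq> 0 \<and> (\<forall>q\<in>Q. g q = 0) \<and> (\<forall>ys. ys \<notin> partial_perms n \<longrightarrow> g ys = 0)"
    if "finite Q" "Q \<subseteq> partial_perms n - {xs}" for Q
    using that
  proof (induction Q rule: finite_induct)
    case empty
    have "component n 0 (Const 1) \<in> ?U" using poly_carrier_Const by (intro fs.span_base) blast
    then show ?case
      using xs by (intro bexI[of _ "component n 0 (Const 1)"]) (auto simp: component_Const simp del: Const_1)
  next
    case (insert q Q)
    then obtain g where g: "g \<in> ?U" "g xs \<noteq> 0" "\<forall>q\<in>Q. g q = 0"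
      "\<forall>ys. ys \<notin> partial_perms n \<longrightarrow> g ys = 0" by auto
    obtain v where v: "v \<in> rays n n" "ray_value n xs v \<noteq> ray_value n q v"
      using ray_value_separates[of xs n q] xs insert.prems by auto
    define h where "h = (\<lambda>ys. ray_value n ys v * g ys) - (\<lambda>ys. ray_value n q v * g ys)"
    have "h \<in> ?U" unfolding h_def by (intro fs.span_diff U_mult fs.span_scale g(1) v(1))
    moreover have "h ys = (ray_value n ys v - ray_value n q v) * g ys" for ys
      by (simp add: h_def algebra_simps)
    ultimately show ?case using g v by (intro bexI[of _ h]) auto
  qed
  from this[of "partial_perms n - {xs}"] finite_partial_perms
  obtain g where g: "g \<in> ?U" "g xs \<noteq> 0" "\<forall>q\<in>partial_perms n - {xs}. g q = 0"
    "\<forall>ys. ys \<notin> partial_perms n \<longrightarrow> g ys = 0" by (auto simp: finite_Diff)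
  then have "(\<lambda>ys. inverse (g xs) * g ys) = (\<lambda>ys. if ys = xs then 1 else 0)"
    by (auto simp: fun_eq_iff)
  then show ?thesis using fs.span_scale[OF g(1), of "inverse (g xs)"] by simp
qed

lemma independent_indicators:
  "fs.independent ((\<lambda>xs ys. if ys = xs then 1 else 0) ` partial_perms n)"
  "card ((\<lambda>xs ys. if ys = xs then (1::rat) else 0) ` partial_perms n) = card (partial_perms n)"
proof -
  let ?ind = "\<lambda>xs ys. if ys = xs then (1::rat) else 0"
  have inj: "inj_on ?ind (partial_perms n)"
    by (intro inj_onI) (metis (full_types) zero_neq_one)
  then show "card (?ind ` partial_perms n) = card (partial_perms n)" by (rule card_image)
  show "fs.independent (?ind ` partial_perms n)"
  proof (rule fs.independent_if_scalars_zero)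
    fix f x assume sum: "(\<Sum>g\<in>?ind ` partial_perms n. (\<lambda>ys. f g * g ys)) = 0"
      and x: "x \<in> ?ind ` partial_perms n"
    then obtain xs where xs: "xs \<in> partial_perms n" "x = ?ind xs" by blast
    have "0 = (\<Sum>g\<in>?ind ` partial_perms n. f g * g xs)"
      using fun_cong[OF sum, of xs] by (simp add: sum_fun_apply)
    also have "\<dots> = (\<Sum>zs\<in>partial_perms n. f (?ind zs) * ?ind zs xs)"
      using inj by (simp add: sum.reindex)
    also have "\<dots> = (\<Sum>zs\<in>partial_perms n. if xs = zs then f (?ind zs) else 0)"
      by (intro sum.cong) auto
    also have "\<dots> = f x" using xs finite_partial_perms by simp
    finally show "f x = 0" by simp
  qed (simp add: finite_partial_perms)
qed

text \<open>A relation with \<open>c b0 \<noteq> 0\<close> makes \<open>b0\<close> superfluous in its degree, up to lower degrees. As the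
  retral monomials span the Chow ring, an induction on the degree shows that the functions of the
  remaining ones span all functions on the points. But there are at least as many points as retral
  monomials.\<close>

lemma retral_monomials_independent_top_rank:
  assumes rel: "(\<Sum>b\<in>retral_monomials n n. Const (c b) * b) \<in> chow_ideal n n"
    and b0: "b0 \<in> retral_monomials n n"
  shows "c b0 = 0"
proof (rule ccontr)
  assume c0: "c b0 \<noteq> 0"
  let ?B = "retral_monomials n n"
  have finB: "finite ?B" by (rule card_retral_monomials_le)
  define dg where "dg b = (SOME e. \<forall>d. d \<noteq> e \<longrightarrow> component n d b = 0)" for b
  have dg: "component n d b = 0" if "b \<in> ?B" "d \<noteq> dg b" for b d
    using someI_ex[OF retral_monomial_homogeneous[OF that(1)]] that(2) unfolding dg_def by blast
  define E where "E = (\<lambda>b. component n (dg b) b) ` (?B - {b0})"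
  have Eb: "component n d b \<in> fs.span E" if "b \<in> ?B - {b0}" for b d
    using that dg[of b d] fs.span_zero fs.span_base[of _ E] unfolding E_def by (cases "d = dg b") auto
  have lower: "lower_values n d \<subseteq> fs.span E" for d
  proof (induction d)
    case 0
    then show ?case using fs.span_zero by (simp add: lower_values_def)
  next
    case (Suc d)
    have all: "component n d b \<in> fs.span E" if b: "b \<in> ?B" for b
    proof (cases "b = b0")
      case False
      then show ?thesis using b Eb by blast
    next
      case b_eq: True
      show ?thesis
      proof (cases "d = dg b0")
        case False
        then show ?thesis using dg b b_eq fs.span_zero by simp
      next
        case True
        let ?rest = "\<Sum>b\<in>?B - {b0}. (\<lambda>xs. c b * component n d b xs)"
        have "component n d (\<Sum>b\<in>?B. Const (c b) * b)
            = (\<lambda>xs. c b0 * component n d b0 xs) + ?rest"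
          unfolding component_sum component_Const_mult using finB b0 by (rule sum.remove)
        moreover have "component n d (\<Sum>b\<in>?B. Const (c b) * b) \<in> fs.span E"
          using component_chow_ideal[OF rel] Suc.IH by blast
        moreover have "?rest \<in> fs.span E" by (intro fs.span_sum fs.span_scale Eb)
        ultimately have "(\<lambda>xs. c b0 * component n d b0 xs) \<in> fs.span E"
          using fs.span_diff by fastforce
        then have "(\<lambda>xs. inverse (c b0) * (c b0 * component n d b0 xs)) \<in> fs.span E"
          by (rule fs.span_scale)
        then show ?thesis using c0 b_eq by (simp add: mult.assoc[symmetric])
      qed
    qed
    have "component n e p \<in> fs.span E" if p: "e < Suc d" "p \<in> poly_carrier (rays n n)" for e p
    proof (cases "e = d")
      case False
      then show ?thesis using p component_in_lower_values[of e d p n] Suc.IH by auto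
    next
      case True
      have "p \<in> mp.span (chow_ideal n n \<union> ?B)" using p poly_carrier_subset_span by blast
      then have "component n d p \<in> fs.span E"
      proof (induction p rule: mp.span_induct)
        case base
        show ?case
          using fs.span_zero fs.span_add fs.span_scale
          by (intro mp.subspaceI) (simp_all add: component_add component_Const_mult)
      next
        case (step p)
        then show ?case using all component_chow_ideal Suc.IH by blast
      qed
      then show ?thesis using True by simp
    qed
    then show ?case
      unfolding lower_values_def[of n "Suc d"] by (intro fs.span_minimal) auto
  qed
  have "component n e p \<in> fs.span E" if "p \<in> poly_carrier (rays n n)" for e p
    using component_in_lower_values[of e "Suc e" p n] that lower by blast
  then have "fs.span {component n e p | e p. p \<in> poly_carrier (rays n n)} \<subseteq> fs.span E"
    by (intro fs.span_minimal) auto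
  then have sub: "(\<lambda>xs ys. if ys = xs then (1::rat) else 0) ` partial_perms n \<subseteq> fs.span E"
    using indicator_in_values by blast
  have finE: "finite E" unfolding E_def using finB by simp
  have "card (partial_perms n) = card ((\<lambda>xs ys. if ys = xs then (1::rat) else 0) ` partial_perms n)"
    by (rule independent_indicators(2)[symmetric])
  also have "\<dots> \<le> card E"
    by (rule conjunct2[OF fs.independent_span_bound[OF finE independent_indicators(1) sub]])
  also have "\<dots> \<le> card (?B - {b0})" unfolding E_def using finB by (intro card_image_le) simp
  also have "\<dots> < card ?B" using finB b0 by (intro psubset_card_mono) auto
  also have "\<dots> \<le> card (partial_perms n)" by (rule card_retral_monomials_le)
  finally show False by simp
qed

lemma retral_not_in_span_top_rank:
  assumes b: "b \<in> retral_monomials n n" and s: "s \<in> mp.span (retral_monomials n n - {b})"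
  shows "b - s \<notin> chow_ideal n n"
proof
  let ?B = "retral_monomials n n"
  assume rel: "b - s \<in> chow_ideal n n"
  have fin: "finite ?B" by (rule card_retral_monomials_le)
  obtain u where s: "s = (\<Sum>v\<in>?B - {b}. Const (u v) * v)"
    using s fin by (auto simp: mp.span_finite)
  define c where "c = (\<lambda>v. if v = b then 1 else - u v)"
  have "(\<Sum>v\<in>?B. Const (c v) * v) = Const (c b) * b + (\<Sum>v\<in>?B - {b}. Const (c v) * v)"
    using fin b by (rule sum.remove)
  also have "(\<Sum>v\<in>?B - {b}. Const (c v) * v) = - s"
    unfolding s sum_negf[symmetric] by (intro sum.cong) (auto simp: c_def Const_minus)
  finally have "(\<Sum>v\<in>?B. Const (c v) * v) = b - s" by (simp add: c_def)
  then have "c b = 0" using retral_monomials_independent_top_rank[OF _ b, of c] rel by simp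
  then show False by (simp add: c_def)
qed

section \<open>Linear independence in all ranks\<close>

lemma proper_flat_mono: "r \<le> n \<Longrightarrow> proper_flat r n F \<Longrightarrow> proper_flat n n F"
  by (simp add: proper_flat_def)

lemma rays_mono: "r \<le> n \<Longrightarrow> rays r n \<subseteq> rays n n"
  by (auto simp: rays_def uniform_indep_def proper_flat_def)

lemma span_chow_ideal: "mp.span (chow_ideal r n) = chow_ideal r n"
  using subspace_chow_ideal by (rule mp.span_eq_iff[THEN iffD2])

text \<open>The ideal that becomes zero under the restriction from rank \<open>n\<close> to rank \<open>r\<close>.\<close>

definition truncation_kernel :: "nat \<Rightarrow> nat \<Rightarrow> ray mpoly set" where
  "truncation_kernel r n = mp.span (chow_ideal n n \<union>
     {xvar F * p | F p. proper_flat n n F \<and> r \<le> card F \<and> p \<in> poly_carrier (rays n n)})"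

lemma truncation_kernel_chow_ideal: "p \<in> chow_ideal n n \<Longrightarrow> p \<in> truncation_kernel r n"
  unfolding truncation_kernel_def by (intro mp.span_base) blast

lemma truncation_kernel_xvar:
  "proper_flat n n F \<Longrightarrow> r \<le> card F \<Longrightarrow> p \<in> poly_carrier (rays n n) \<Longrightarrow> xvar F * p \<in> truncation_kernel r n"
  unfolding truncation_kernel_def by (intro mp.span_base) blast

lemma subspace_truncation_kernel: "mp.subspace (truncation_kernel r n)"
  by (simp add: truncation_kernel_def)

lemma truncation_kernel_mult:
  assumes p: "p \<in> poly_carrier (rays n n)" and q: "q \<in> truncation_kernel r n"
  shows "p * q \<in> truncation_kernel r n"
  using q unfolding truncation_kernel_def[of r n]
proof (induction q rule: mp.span_induct)
  case base
  have comm: "p * (Const c * q) = Const c * (p * q)" for c q by (simp add: mult_ac)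
  show ?case
    unfolding truncation_kernel_def[symmetric]
    by (intro mp.subspaceI)
       (simp_all add: distrib_left comm mp.subspace_0[OF subspace_truncation_kernel]
         mp.subspace_add[OF subspace_truncation_kernel] mp.subspace_scale[OF subspace_truncation_kernel])
next
  case (step q)
  show ?case
  proof (cases "q \<in> chow_ideal n n")
    case True
    then have "p * q \<in> truncation_kernel r n"
      using p by (intro truncation_kernel_chow_ideal chow_ideal.mult)
    then show ?thesis unfolding truncation_kernel_def .
  next
    case False
    then obtain F p' where q: "q = xvar F * p'" "proper_flat n n F" "r \<le> card F"
      "p' \<in> poly_carrier (rays n n)" using step by blast
    then have "xvar F * (p * p') \<in> truncation_kernel r n"
      using p by (intro truncation_kernel_xvar poly_carrier_mult)
    moreover have "p * q = xvar F * (p * p')" unfolding q(1) by (simp add: mult_ac)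
    ultimately show ?thesis unfolding truncation_kernel_def by simp
  qed
qed

text \<open>Eliminating one factor \<open>y\<^bsub>i0\<^esub>\<close> leaves terms with an \<open>x\<^bsub>F\<^esub>\<close>, and such a term vanishes unless
  \<open>F\<close> contains the at least \<open>r\<close> indices of the other factors.\<close>

lemma yvar_product_in_truncation_kernel:
  assumes I: "I \<subseteq> {1..n}" and card: "r < card I"
  shows "(\<Prod>i\<in>I. yvar i) \<in> truncation_kernel r n"
proof -
  have finI: "finite I" using I finite_subset by blast
  obtain i0 where i0: "i0 \<in> I" using card by fastforce
  then have i0n: "i0 \<in> {1..n}" "1 \<le> n" using I by auto
  define q where "q = (\<Prod>i\<in>I - {i0}. yvar i)"
  have y: "yvar i \<in> poly_carrier (rays n n)" if "i \<in> I" for i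
    using that I i0n(2) RayE_in_rays by (intro poly_carrier_Var) blast
  have q: "q \<in> poly_carrier (rays n n)" unfolding q_def using y by (intro poly_carrier_prod) blast
  have "(\<Prod>i\<in>I. yvar i) = yvar i0 * q" unfolding q_def using finI i0 by (rule prod.remove)
  also have "\<dots> = q * theta n n i0 + (\<Sum>F\<in>{F. proper_flat n n F \<and> i0 \<notin> F}. xvar F * q)"
    unfolding theta_eq[OF i0n] avoiding_sum_def by (simp add: algebra_simps sum_distrib_left)
  also have "\<dots> \<in> truncation_kernel r n"
  proof (intro mp.subspace_add mp.subspace_sum subspace_truncation_kernel)
    show "q * theta n n i0 \<in> truncation_kernel r n"
      using q i0n(1) by (intro truncation_kernel_chow_ideal chow_ideal.mult chow_ideal.theta)
    fix F assume F: "F \<in> {F. proper_flat n n F \<and> i0 \<notin> F}"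
    show "xvar F * q \<in> truncation_kernel r n"
    proof (cases "I - {i0} \<subseteq> F")
      case True
      then have "card (I - {i0}) \<le> card F" using F finite_proper_flat by (intro card_mono) auto
      then have "r \<le> card F" using card i0 finI by simp
      then show ?thesis using F q by (intro truncation_kernel_xvar) auto
    next
      case False
      then obtain i where i: "i \<in> I - {i0}" "i \<notin> F" by blast
      define q' where "q' = (\<Prod>i\<in>I - {i0} - {i}. yvar i)"
      have "q = yvar i * q'" unfolding q_def q'_def using finI i(1) by (intro prod.remove) auto
      then have "xvar F * q = q' * (xvar F * yvar i)" by (simp add: mult_ac)
      moreover have "q' \<in> poly_carrier (rays n n)"
        unfolding q'_def using y by (intro poly_carrier_prod) blast
      moreover have "xvar F * yvar i \<in> chow_ideal n n"
        using F i I by (intro yvar_xvar_in_chow_ideal) auto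
      ultimately show ?thesis using truncation_kernel_chow_ideal chow_ideal.mult by simp
    qed
  qed
  finally show ?thesis .
qed

text \<open>The fan in rank \<open>r\<close> is a subfan of the one in rank \<open>n\<close>. Among the non-faces consisting of
  rays of rank \<open>r\<close>, the only faces of the larger fan are the sets of more than \<open>r\<close> rays \<open>e\<^sub>i\<close>.
  The linear forms of the two ranks differ by variables of flats with at least \<open>r\<close> elements.\<close>

lemma chow_ideal_subset_truncation_kernel:
  assumes rn: "r \<le> n"
  shows "p \<in> chow_ideal r n \<Longrightarrow> p \<in> truncation_kernel r n"
proof (induction p rule: chow_ideal.induct)
  case zero
  show ?case by (rule mp.subspace_0[OF subspace_truncation_kernel])
next
  case (nonface S)
  have Sn: "S \<subseteq> rays n n" using nonface.hyps(1) rays_mono[OF rn] by blast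
  have nf: "\<not> face r n S" using nonface.hyps face_imp_cone by blast
  show ?case
  proof (cases "face n n S")
    case False
    then show ?thesis
      using Sn by (intro truncation_kernel_chow_ideal chow_ideal.nonface) (simp_all add: cone_in_fan_iff_face)
  next
    case True
    then obtain I C where S: "S = RayE ` I \<union> RayF ` C" and I: "uniform_indep n n I"
      and C: "subset.chain {F. proper_flat n n F} C" and IC: "\<forall>F\<in>C. I \<subseteq> F"
      unfolding face_def by blast
    have Cr: "proper_flat r n F" if "F \<in> C" for F
      using that S nonface.hyps(1) RayF_in_rays by blast
    have "\<not> uniform_indep r n I"
    proof
      assume "uniform_indep r n I"
      moreover have "subset.chain {F. proper_flat r n F} C"
        using C Cr unfolding subset_chain_def by blast
      ultimately show False using nf S IC unfolding face_def by blast
    qed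
    then have In: "I \<subseteq> {1..n}" and card: "r < card I" using I by (auto simp: uniform_indep_def)
    have "C = {}"
    proof (rule ccontr)
      assume "C \<noteq> {}"
      then obtain F where F: "F \<in> C" by blast
      then have "card I \<le> card F" using IC Cr finite_proper_flat by (intro card_mono) blast+
      then show False using Cr[OF F] card by (simp add: proper_flat_def)
    qed
    then have "(\<Prod>\<rho>\<in>S. Var \<rho>) = (\<Prod>i\<in>I. yvar i)"
      unfolding S by (simp add: prod.reindex inj_on_def)
    then show ?thesis using yvar_product_in_truncation_kernel[OF In card] by simp
  qed
next
  case (theta i)
  show ?case
  proof (cases "1 \<le> r")
    case False
    then have "rays r n = {}" by (auto simp: rays_def uniform_indep_def proper_flat_def)
    then have "theta r n i = 0" by (simp add: theta_def)
    then show ?thesis using mp.subspace_0[OF subspace_truncation_kernel] by simp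
  next
    case True
    let ?A = "{F. proper_flat n n F \<and> i \<notin> F}" and ?B = "{F. proper_flat r n F \<and> i \<notin> F}"
    have finA: "finite ?A" by (rule finite_subset[OF _ finite_proper_flats[of n n]]) blast
    have sub: "?B \<subseteq> ?A" using proper_flat_mono[OF rn] by blast
    have "theta r n i = theta n n i + (\<Sum>F\<in>?A - ?B. xvar F)"
      using theta_eq[OF theta.hyps True] theta_eq[of i n n] True rn theta.hyps
        sum.subset_diff[OF sub finA, of xvar]
      unfolding avoiding_sum_def by simp
    also have "\<dots> \<in> truncation_kernel r n"
    proof (intro mp.subspace_add mp.subspace_sum subspace_truncation_kernel)
      show "theta n n i \<in> truncation_kernel r n"
        using theta.hyps by (intro truncation_kernel_chow_ideal chow_ideal.theta)
      fix F assume "F \<in> ?A - ?B"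
      then have "proper_flat n n F" "r \<le> card F" by (auto simp: proper_flat_def)
      then show "xvar F \<in> truncation_kernel r n"
        using truncation_kernel_xvar[OF _ _ poly_carrier_one] by fastforce
    qed
    finally show ?thesis .
  qed
next
  case (add p q)
  then show ?case by (intro mp.subspace_add[OF subspace_truncation_kernel])
next
  case (mult p q)
  then show ?case
    using poly_carrier_mono[OF rays_mono[OF rn]] by (intro truncation_kernel_mult) auto
qed

definition high_retral_monomials :: "nat \<Rightarrow> nat \<Rightarrow> ray mpoly set" where
  "high_retral_monomials r n =
     {chain_monomial (set fl) | fl. retral n n (hd fl) fl \<and> (\<exists>F\<in>set fl. r \<le> card F)}"

text \<open>Here it matters that straightening never loses the flats with at least \<open>r\<close> elements.\<close>

lemma truncation_kernel_subset_span:
  "truncation_kernel r n \<subseteq> mp.span (chow_ideal n n \<union> high_retral_monomials r n)"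
proof -
  define M where "M = mp.span (chow_ideal n n \<union> high_retral_monomials r n)"
  have M: "mp.subspace M" "chow_ideal n n \<subseteq> M" and high: "high_retral_monomials r n \<subseteq> M"
    unfolding M_def using mp.span_superset[of "chow_ideal n n \<union> high_retral_monomials r n"] by auto
  have "xvar F * p \<in> M"
    if F: "proper_flat n n F" "r \<le> card F" and p: "p \<in> poly_carrier (rays n n)" for F p
  proof (rule xvar_multiple_in_subspace[OF order_refl M _ F p])
    fix fl assume "retral n n (hd fl) fl" "\<exists>F\<in>set fl. r \<le> card F"
    then show "chain_monomial (set fl) \<in> M" using high unfolding high_retral_monomials_def by blast
  qed
  then show ?thesis
    unfolding truncation_kernel_def M_def[symmetric] using M by (intro mp.span_minimal) auto
qed

lemma chain_monomial_eq_single: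
  "finite C \<Longrightarrow> chain_monomial C = Poly_Mapping.single (\<Sum>F\<in>C. Poly_Mapping.single (RayF F) 1) 1"
proof (induction C rule: finite_induct)
  case (insert F C)
  then show ?case
    unfolding chain_monomial_insert[OF insert.hyps] insert.IH Var_mult_single
    by (simp add: add.commute)
qed (simp add: chain_monomial_def)

lemma chain_monomial_inj:
  assumes "finite C" "finite D" "chain_monomial C = chain_monomial D"
  shows "C = D"
proof -
  have lk: "Poly_Mapping.lookup (\<Sum>F\<in>E. Poly_Mapping.single (RayF F) (1::nat)) (RayF G)
      = (if G \<in> E then 1 else 0)" if "finite E" for E G
    using that by (simp add: lookup_sum lookup_single when_def)
  have "Poly_Mapping.keys (chain_monomial C) = Poly_Mapping.keys (chain_monomial D)"
    using assms(3) by simp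
  then have "(\<Sum>F\<in>C. Poly_Mapping.single (RayF F) (1::nat)) = (\<Sum>F\<in>D. Poly_Mapping.single (RayF F) 1)"
    using assms(1,2) by (simp add: chain_monomial_eq_single)
  then have "(if G \<in> C then 1 else (0::nat)) = (if G \<in> D then 1 else 0)" for G
    using lk[OF assms(1), of G] lk[OF assms(2), of G] by simp
  then show ?thesis by (metis (full_types) subsetI subset_antisym zero_neq_one)
qed

lemma retral_mono:
  assumes "r \<le> n" "retral r n F fl"
  shows "retral n n F fl"
proof -
  have "contraction_flag n n F fl" if "contraction_flag r n F fl"
    using that proper_flat_mono[OF assms(1)] unfolding contraction_flag_def by blast
  then show ?thesis using assms(2) unfolding retral_def by simp
qed

lemma retral_monomials_split:
  assumes rn: "r \<le> n"
  shows "retral_monomials r n \<subseteq> retral_monomials n n"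
    and "high_retral_monomials r n \<subseteq> retral_monomials n n"
    and "retral_monomials r n \<inter> high_retral_monomials r n = {}"
proof -
  show "retral_monomials r n \<subseteq> retral_monomials n n"
    using retral_mono[OF rn] unfolding retral_monomials_eq by blast
  show "high_retral_monomials r n \<subseteq> retral_monomials n n"
    unfolding retral_monomials_eq high_retral_monomials_def by blast
  show "retral_monomials r n \<inter> high_retral_monomials r n = {}"
  proof (rule ccontr)
    assume "\<not> ?thesis"
    then obtain b where b: "b \<in> retral_monomials r n" "b \<in> high_retral_monomials r n" by blast
    obtain C where C: "b = chain_monomial C" "finite C" "\<forall>F\<in>C. proper_flat r n F"
    proof (cases "b = 1")
      case True
      then show thesis by (intro that[of "{}"]) (simp_all add: chain_monomial_def)
    next
      case False
      then obtain gl where "b = chain_monomial (set gl)" "retral r n (hd gl) gl"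
        using b(1) unfolding retral_monomials_eq by blast
      then show thesis using retral_proper by (intro that[of "set gl"]) auto
    qed
    obtain fl where fl: "b = chain_monomial (set fl)" "\<exists>F\<in>set fl. r \<le> card F"
      using b(2) unfolding high_retral_monomials_def by blast
    have "C = set fl" using chain_monomial_inj[of C "set fl"] C fl by simp
    then show False using C fl by (auto simp: proper_flat_def)
  qed
qed

text \<open>In rank \<open>n\<close>, a relation of rank \<open>r\<close> becomes a relation between its retral monomials and those
  with a flat of at least \<open>r\<close> elements. These are different retral monomials of rank \<open>n\<close>.\<close>

lemma retral_not_in_span:
  assumes rn: "r \<le> n" and b: "b \<in> retral_monomials r n"
    and s: "s \<in> mp.span (retral_monomials r n - {b})"
  shows "b - s \<notin> chow_ideal r n"
proof
  assume "b - s \<in> chow_ideal r n"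
  then have "b - s \<in> mp.span (chow_ideal n n \<union> high_retral_monomials r n)"
    using chow_ideal_subset_truncation_kernel[OF rn] truncation_kernel_subset_span by blast
  then obtain j h where jh: "b - s = j + h" "j \<in> mp.span (chow_ideal n n)"
    "h \<in> mp.span (high_retral_monomials r n)" unfolding mp.span_Un by blast
  note split = retral_monomials_split[OF rn]
  have "s \<in> mp.span (retral_monomials n n - {b})"
    using s split(1) mp.span_mono[of "retral_monomials r n - {b}" "retral_monomials n n - {b}"] by blast
  moreover have "h \<in> mp.span (retral_monomials n n - {b})"
    using jh(3) split(2,3) b
      mp.span_mono[of "high_retral_monomials r n" "retral_monomials n n - {b}"] by blast
  ultimately have "s + h \<in> mp.span (retral_monomials n n - {b})" by (rule mp.span_add)
  then have "b - (s + h) \<notin> chow_ideal n n"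
    using retral_not_in_span_top_rank b split(1) by blast
  moreover have "j \<in> chow_ideal n n" using jh(2) by (simp only: span_chow_ideal)
  moreover have "b - (s + h) = j" using jh(1) by (simp add: algebra_simps)
  ultimately show False by simp
qed

section \<open>Bases of the augmented Chow ring\<close>

lemma ring_aug_chow_ring: "ring (aug_chow_ring r n)"
  using chow_class_hom by (rule ring_hom_ring.axioms(2))

lemma chow_class_ops:
  assumes "p \<in> poly_carrier (rays r n)" "q \<in> poly_carrier (rays r n)"
  shows "chow_class r n (p + q) = chow_class r n p \<oplus>\<^bsub>aug_chow_ring r n\<^esub> chow_class r n q"
    and "chow_class r n (p * q) = chow_class r n p \<otimes>\<^bsub>aug_chow_ring r n\<^esub> chow_class r n q"
proof -
  interpret c: ring_hom_ring "poly_ring (rays r n)" "aug_chow_ring r n" "chow_class r n"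
    by (rule chow_class_hom)
  have ops: "p \<oplus>\<^bsub>poly_ring (rays r n)\<^esub> q = p + q" "p \<otimes>\<^bsub>poly_ring (rays r n)\<^esub> q = p * q"
    by (simp_all add: poly_ring_def)
  show "chow_class r n (p + q) = chow_class r n p \<oplus>\<^bsub>aug_chow_ring r n\<^esub> chow_class r n q"
    using c.hom_add[of p q] assms by (simp add: ops)
  show "chow_class r n (p * q) = chow_class r n p \<otimes>\<^bsub>aug_chow_ring r n\<^esub> chow_class r n q"
    using c.hom_mult[of p q] assms by (simp add: ops)
qed

lemma chow_class_zero: "chow_class r n 0 = \<zero>\<^bsub>aug_chow_ring r n\<^esub>"
proof -
  interpret c: ring_hom_ring "poly_ring (rays r n)" "aug_chow_ring r n" "chow_class r n"
    by (rule chow_class_hom)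
  show ?thesis using c.hom_zero by (simp add: poly_ring_def)
qed

text \<open>The scalars are the classes of the constants, so a span in the quotient is the image of the
  rational span in the polynomial ring. The recursion of \<open>Span\<close> adds one generator at a time.\<close>

lemma Span_chow_class:
  assumes "set bs \<subseteq> poly_carrier (rays r n)"
  shows "ring.Span (aug_chow_ring r n) (chow_scalars r n) (map (chow_class r n) bs)
    = chow_class r n ` mp.span (set bs)"
  using assms
proof (induction bs)
  case Nil
  show ?case by (simp add: ring.Span.simps[OF ring_aug_chow_ring] chow_class_zero)
next
  case (Cons b bs)
  interpret A: ring "aug_chow_ring r n" by (rule ring_aug_chow_ring)
  let ?cc = "chow_class r n"
  have carr: "mp.span (set bs) \<subseteq> poly_carrier (rays r n)"
    using Cons.prems subspace_poly_carrier by (intro mp.span_minimal) auto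
  have b: "Const a * b \<in> poly_carrier (rays r n)" for a
    using Cons.prems by (intro poly_carrier_mult poly_carrier_Const) auto
  have eq: "?cc (Const a * b + s) = ?cc (Const a) \<otimes>\<^bsub>aug_chow_ring r n\<^esub> ?cc b \<oplus>\<^bsub>aug_chow_ring r n\<^esub> ?cc s"
    if "s \<in> mp.span (set bs)" for a s
    using that carr b[of a] Cons.prems chow_class_ops poly_carrier_Const[of a "rays r n"]
    by (metis list.set_intros(1) subsetD)
  have "A.Span (chow_scalars r n) (map ?cc (b # bs))
      = A.line_extension (chow_scalars r n) (?cc b) (?cc ` mp.span (set bs))"
    using Cons.IH Cons.prems by simp
  also have "\<dots> = ?cc ` mp.span (set (b # bs))"
  proof (intro equalityI subsetI)
    fix u assume "u \<in> A.line_extension (chow_scalars r n) (?cc b) (?cc ` mp.span (set bs))"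
    then obtain a s where s: "s \<in> mp.span (set bs)"
      and u: "u = ?cc (Const a) \<otimes>\<^bsub>aug_chow_ring r n\<^esub> ?cc b \<oplus>\<^bsub>aug_chow_ring r n\<^esub> ?cc s"
      unfolding A.line_extension_mem_iff chow_scalars_def by blast
    have "Const a * b + s \<in> mp.span (set (b # bs))"
      using s by (auto simp: mp.span_insert intro!: exI[of _ a])
    then show "u \<in> ?cc ` mp.span (set (b # bs))" unfolding u eq[OF s, symmetric] by blast
  next
    fix u assume "u \<in> ?cc ` mp.span (set (b # bs))"
    then obtain p a where p: "u = ?cc p" "p - Const a * b \<in> mp.span (set bs)"
      by (auto simp: mp.span_insert)
    have "u = ?cc (Const a) \<otimes>\<^bsub>aug_chow_ring r n\<^esub> ?cc b \<oplus>\<^bsub>aug_chow_ring r n\<^esub> ?cc (p - Const a * b)"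
      using eq[OF p(2), of a] p(1) by simp
    then show "u \<in> A.line_extension (chow_scalars r n) (?cc b) (?cc ` mp.span (set bs))"
      unfolding A.line_extension_mem_iff chow_scalars_def using p(2) by blast
  qed
  finally show ?case .
qed

lemma retral_monomials_carrier:
  "retral_monomials r n \<subseteq> poly_carrier (rays r n)"
  unfolding retral_monomials_eq
  using retral_proper by (auto intro!: poly_carrier_one chain_monomial_carrier)

theorem corollary3p2:
  fixes r n :: nat
  assumes "r \<le> n"
  shows "inj_on (chow_class r n) (retral_monomials r n) \<and>
    is_basis (aug_chow_ring r n) (chow_scalars r n) (chow_class r n ` retral_monomials r n)"
proof
  let ?B = "retral_monomials r n" and ?cc = "chow_class r n" and ?A = "aug_chow_ring r n"
  interpret A: ring ?A by (rule ring_aug_chow_ring)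
  have carr: "p \<in> poly_carrier (rays r n)" if "p \<in> mp.span ?B" for p
    using that mp.span_minimal[OF retral_monomials_carrier subspace_poly_carrier] by blast
  have indep: "?cc b \<noteq> ?cc s" if "b \<in> ?B" "s \<in> mp.span (?B - {b})" for b s
  proof -
    have "s \<in> mp.span ?B" using that(2) mp.span_mono[of "?B - {b}" ?B] by blast
    then show ?thesis
      using chow_class_eq_iff[of b r n s] carr[of s] that retral_monomials_carrier
        retral_not_in_span[OF assms that] by blast
  qed
  show inj: "inj_on ?cc ?B"
  proof (rule inj_onI, rule ccontr)
    fix b b' assume "b \<in> ?B" "b' \<in> ?B" "?cc b = ?cc b'" "b \<noteq> b'"
    then show False using indep[of b b'] by (simp add: mp.span_base)
  qed
  have "finite ?B"
    using retral_monomials_split(1)[OF assms] card_retral_monomials_le(1) finite_subset by blast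
  then obtain bs where bs: "set bs = ?B" "distinct bs" using finite_distinct_list by blast
  have "A.independent (chow_scalars r n) (map ?cc xs)" if "set xs \<subseteq> ?B" "distinct xs" for xs
    using that
  proof (induction xs)
    case (Cons b xs)
    have b: "b \<in> ?B" using Cons.prems by simp
    have sub: "mp.span (set xs) \<subseteq> mp.span (?B - {b})"
      using Cons.prems by (intro mp.span_mono) auto
    have "set xs \<subseteq> poly_carrier (rays r n)"
      using Cons.prems retral_monomials_carrier[of r n] by auto
    moreover have "?cc b \<notin> ?cc ` mp.span (set xs)" using indep[OF b] sub by blast
    ultimately have "?cc b \<notin> A.Span (chow_scalars r n) (map ?cc xs)"
      using Span_chow_class[of xs r n] by simp
    moreover have "?cc b \<in> carrier ?A"
      using b retral_monomials_carrier by (auto simp: chow_class_surj)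
    ultimately show ?case using Cons by (auto intro: A.li_Cons)
  qed simp
  then have "A.independent (chow_scalars r n) (map ?cc bs)" using bs by simp
  moreover have "A.Span (chow_scalars r n) (map ?cc bs) = carrier ?A"
  proof -
    have "?cc p \<in> ?cc ` mp.span ?B" if p: "p \<in> poly_carrier (rays r n)" for p
    proof -
      obtain j s where js: "p = j + s" "j \<in> mp.span (chow_ideal r n)" "s \<in> mp.span ?B"
        using p poly_carrier_subset_span[OF assms] unfolding mp.span_Un by blast
      then have "p - s \<in> chow_ideal r n" by (simp add: span_chow_ideal)
      then have "?cc p = ?cc s" using chow_class_eq_iff[OF p carr[OF js(3)]] by simp
      then show ?thesis using js(3) by blast
    qed
    then have "carrier ?A = ?cc ` mp.span ?B" using carr by (auto simp: chow_class_surj)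
    then show ?thesis using Span_chow_class[of bs r n] bs(1) retral_monomials_carrier by simp
  qed
  moreover have "distinct (map ?cc bs)" using bs inj by (simp add: distinct_map)
  ultimately show "is_basis ?A (chow_scalars r n) (?cc ` ?B)"
    unfolding is_basis_def using bs(1) by (intro exI[of _ "map ?cc bs"]) simp
qed

end
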